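(* Let $X$ be a compact Hausdorff space and let $\Gamma$ be a discrete group acting on $X$ by homeomorphisms. Let $\mathcal D=C(X)$, $\mathcal C=C(X)\rtimes_r\Gamma$, and let $\mathcal D^c$ be the relative commutant of $\mathcal D$ in $\mathcal C$. Suppose that for each $x\in X$ the germ isotropy group $H^x$ is abelian. Then $\mathcal L(\mathcal C,\mathcal D^c)=(0)$.
   Context: For $s\in\Gamma$ and $f\in C(X)$ let $\alpha_s(f)(x)=f(s^{-1}x)$; $C(X)\rtimes_r\Gamma$ is the reduced crossed product for this action, in which $\mathcal D=C(X)$ is identified with its canonical image. $\mathcal D^c=\{a\in\mathcal C: ad=da\text{ for all }d\in\mathcal D\}$. For $s\in\Gamma$, $F_s=\{x\in X:sx=x\}$ and $F_s^\circ$ is its interior. The germ isotropy group at $x$ is $H^x=\{s\in\Gamma:x\in F_s^\circ\}$. For a unital $C^*$-algebra $\mathcal C$ and an abelian $C^*$-subalgebra $\mathcal B$ containing the unit, let $\mathcal N(\mathcal C,\mathcal B)=\{v\in\mathcal C:v^*\mathcal Bv\cup v\mathcal Bv^*\subseteq\mathcal B\}$. $(\mathcal C,\mathcal B)$ is a regular MASA inclusion if $\mathcal B$ is a maximal abelian $C^*$-subalgebra of $\mathcal C$ and $\operatorname{span}\mathcal N(\mathcal C,\mathcal B)$ is norm dense in $\mathcal C$. Let $(I(\mathcal B),\iota)$ be an injective envelope of $\mathcal B$ ($I(\mathcal B)$ an injective unital abelian $C^*$-algebra, $\iota:\mathcal B\to I(\mathcal B)$ a unital injective $*$-homomorphism that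 is a rigid and essential extension). For a regular MASA inclusion there is a unique unital completely positive map $E:\mathcal C\to I(\mathcal B)$ with $E|_{\mathcal B}=\iota$, and $\mathcal L(\mathcal C,\mathcal B)=\{x\in\mathcal C:E(x^*x)=0\}$. When all $H^x$ are abelian, $\mathcal D^c$ is abelian and $(\mathcal C,\mathcal D^c)$ is a regular MASA inclusion, so $\mathcal L(\mathcal C,\mathcal D^c)$ is defined. *)

theory Defs
  imports "HOL-Analysis.Analysis" "HOL-Library.Nonpos_Ints"
begin

section \<open>The complex Hilbert spaces \<open>\<ell>\<^sup>2(K)\<close>\<close>

text \<open>
  Every complex Hilbert space is unitarily equivalent to some \<open>\<ell>\<^sup>2(K)\<close>, so (by Gelfand and
  Naimark) every C*-algebra is isomorphic to a norm-closed self-adjoint algebra of bounded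
  operators on some \<open>\<ell>\<^sup>2(K)\<close>.  Throughout, C*-algebras and operator systems are taken in this
  concrete form, with \<open>K\<close> an arbitrary type.
\<close>

typedef 'k ell2 = "{f :: 'k \<Rightarrow> complex. (\<lambda>k. (cmod (f k))\<^sup>2) summable_on UNIV}"
  morphisms coord Abs_ell2
  by (rule exI[of _ "\<lambda>_. 0"]) simp

setup_lifting type_definition_ell2

lemma coord_sq_summable: "(\<lambda>k. (cmod (coord \<xi> k))\<^sup>2) summable_on UNIV"
  using coord[of \<xi>] by simp

lemma sq_summable_add:
  fixes f g :: "'k \<Rightarrow> complex"
  assumes "(\<lambda>k. (cmod (f k))\<^sup>2) summable_on UNIV" "(\<lambda>k. (cmod (g k))\<^sup>2) summable_on UNIV"
  shows "(\<lambda>k. (cmod (f k + g k))\<^sup>2) summable_on UNIV"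
proof (rule summable_on_comparison_test)
  show "(\<lambda>k. 2 * (cmod (f k))\<^sup>2 + 2 * (cmod (g k))\<^sup>2) summable_on UNIV"
    by (intro summable_on_add summable_on_cmult_right assms)
  fix k
  have "(cmod (f k + g k))\<^sup>2 \<le> (cmod (f k) + cmod (g k))\<^sup>2"
    by (intro power_mono norm_triangle_ineq) auto
  also have "\<dots> \<le> 2 * (cmod (f k))\<^sup>2 + 2 * (cmod (g k))\<^sup>2"
    using sum_squares_bound[of "cmod (f k)" "cmod (g k)"] by (simp add: power2_sum)
  finally show "(cmod (f k + g k))\<^sup>2 \<le> 2 * (cmod (f k))\<^sup>2 + 2 * (cmod (g k))\<^sup>2" .
qed auto

lemma sq_summable_mult_bounded:
  fixes f g :: "'k \<Rightarrow> complex"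
  assumes "(\<lambda>k. (cmod (f k))\<^sup>2) summable_on UNIV" "\<And>k. cmod (g k) \<le> M"
  shows "(\<lambda>k. (cmod (g k * f k))\<^sup>2) summable_on UNIV"
proof (rule summable_on_comparison_test)
  show "(\<lambda>k. M\<^sup>2 * (cmod (f k))\<^sup>2) summable_on UNIV"
    by (intro summable_on_cmult_right assms)
  show "(cmod (g k * f k))\<^sup>2 \<le> M\<^sup>2 * (cmod (f k))\<^sup>2" for k
    unfolding norm_mult power_mult_distrib
    by (intro mult_right_mono power_mono assms) auto
qed auto

instantiation ell2 :: (type) real_vector
begin

lift_definition zero_ell2 :: "'a ell2" is "\<lambda>_. 0" by simp
lift_definition plus_ell2 :: "'a ell2 \<Rightarrow> 'a ell2 \<Rightarrow> 'a ell2" is "\<lambda>f g k. f k + g k"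
  by (rule sq_summable_add)
lift_definition uminus_ell2 :: "'a ell2 \<Rightarrow> 'a ell2" is "\<lambda>f k. - f k" by simp
lift_definition minus_ell2 :: "'a ell2 \<Rightarrow> 'a ell2 \<Rightarrow> 'a ell2" is "\<lambda>f g k. f k - g k"
  using sq_summable_add[of _ "\<lambda>k. - _ k"] by simp
lift_definition scaleR_ell2 :: "real \<Rightarrow> 'a ell2 \<Rightarrow> 'a ell2" is "\<lambda>r f k. complex_of_real r * f k"
  by (rule sq_summable_mult_bounded) auto

instance
  by standard (transfer; force simp: algebra_simps)+

end

lift_definition cscale :: "complex \<Rightarrow> 'k ell2 \<Rightarrow> 'k ell2" is "\<lambda>c f k. c * f k"
  by (rule sq_summable_mult_bounded) auto

lemma coord_simps [simp]:
  "coord 0 k = 0" "coord (\<xi> + \<eta>) k = coord \<xi> k + coord \<eta> k" "coord (- \<xi>) k = - coord \<xi> k"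
  "coord (\<xi> - \<eta>) k = coord \<xi> k - coord \<eta> k"
  "coord (r *\<^sub>R \<xi>) k = complex_of_real r * coord \<xi> k" "coord (cscale c \<xi>) k = c * coord \<xi> k"
  by (transfer; simp)+

lemma ell2_eqI: "(\<And>k. coord \<xi> k = coord \<eta> k) \<Longrightarrow> \<xi> = \<eta>"
  by (simp add: coord_inject[symmetric] ext)

definition cinner :: "'k ell2 \<Rightarrow> 'k ell2 \<Rightarrow> complex" where
  "cinner \<xi> \<eta> = (\<Sum>\<^sub>\<infinity>k. coord \<xi> k * cnj (coord \<eta> k))"

lemma cinner_summable: "(\<lambda>k. coord \<xi> k * cnj (coord \<eta> k)) summable_on UNIV"
proof (rule abs_summable_summable, rule summable_on_comparison_test)
  show "(\<lambda>k. (cmod (coord \<xi> k))\<^sup>2 + (cmod (coord \<eta> k))\<^sup>2) summable_on UNIV"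
    by (intro summable_on_add coord_sq_summable)
  fix k
  have "2 * cmod (coord \<xi> k) * cmod (coord \<eta> k) \<le> (cmod (coord \<xi> k))\<^sup>2 + (cmod (coord \<eta> k))\<^sup>2"
    by (rule sum_squares_bound)
  moreover have "0 \<le> cmod (coord \<xi> k) * cmod (coord \<eta> k)"
    by simp
  ultimately show "norm (coord \<xi> k * cnj (coord \<eta> k))
      \<le> (cmod (coord \<xi> k))\<^sup>2 + (cmod (coord \<eta> k))\<^sup>2"
    unfolding norm_mult complex_mod_cnj by linarith
qed auto

lemma cinner_commute: "cinner \<eta> \<xi> = cnj (cinner \<xi> \<eta>)"
  unfolding cinner_def infsum_cnj[symmetric] by (simp add: mult.commute)

lemma cinner_add_left: "cinner (\<xi> + \<xi>') \<eta> = cinner \<xi> \<eta> + cinner \<xi>' \<eta>"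
  unfolding cinner_def
  by (simp add: distrib_right infsum_add cinner_summable)

lemma cinner_cscale_left: "cinner (cscale c \<xi>) \<eta> = c * cinner \<xi> \<eta>"
  unfolding cinner_def
  by (simp add: mult.assoc infsum_cmult_right')

lemma scaleR_eq_cscale: "r *\<^sub>R \<xi> = cscale (complex_of_real r) \<xi>"
  by (rule ell2_eqI) simp

lemma Re_cinner_self: "Re (cinner \<xi> \<xi>) = (\<Sum>\<^sub>\<infinity>k. (cmod (coord \<xi> k))\<^sup>2)"
  unfolding cinner_def infsum_Re[OF cinner_summable, symmetric]
  by (simp add: complex_mult_cnj cmod_power2 flip: power2_eq_square)

instantiation ell2 :: (type) real_inner
begin

definition inner_ell2 :: "'a ell2 \<Rightarrow> 'a ell2 \<Rightarrow> real" where
  "inner_ell2 \<xi> \<eta> = Re (cinner \<xi> \<eta>)"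
definition norm_ell2 :: "'a ell2 \<Rightarrow> real" where
  "norm_ell2 \<xi> = sqrt (inner \<xi> \<xi>)"
definition dist_ell2 :: "'a ell2 \<Rightarrow> 'a ell2 \<Rightarrow> real" where
  "dist_ell2 \<xi> \<eta> = norm (\<xi> - \<eta>)"
definition sgn_ell2 :: "'a ell2 \<Rightarrow> 'a ell2" where
  "sgn_ell2 \<xi> = inverse (norm \<xi>) *\<^sub>R \<xi>"
definition uniformity_ell2 :: "('a ell2 \<times> 'a ell2) filter" where
  "uniformity_ell2 = (INF e\<in>{0<..}. principal {(\<xi>, \<eta>). dist \<xi> \<eta> < e})"
definition open_ell2 :: "'a ell2 set \<Rightarrow> bool" where
  "open_ell2 U = (\<forall>\<xi>\<in>U. eventually (\<lambda>(\<xi>', \<eta>). \<xi>' = \<xi> \<longrightarrow> \<eta> \<in> U) uniformity)"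

instance
proof
  fix \<xi> \<eta> \<zeta> :: "'a ell2" and r :: real
  show "inner \<xi> \<eta> = inner \<eta> \<xi>"
    unfolding inner_ell2_def cinner_commute[of \<eta> \<xi>] by simp
  show "inner (\<xi> + \<eta>) \<zeta> = inner \<xi> \<zeta> + inner \<eta> \<zeta>"
    by (simp add: inner_ell2_def cinner_add_left)
  show "inner (r *\<^sub>R \<xi>) \<eta> = r * inner \<xi> \<eta>"
    by (simp add: inner_ell2_def scaleR_eq_cscale cinner_cscale_left)
  show "0 \<le> inner \<xi> \<xi>"
    unfolding inner_ell2_def Re_cinner_self by (rule infsum_nonneg) auto
  show "inner \<xi> \<xi> = 0 \<longleftrightarrow> \<xi> = 0"
  proof
    assume *: "inner \<xi> \<xi> = 0"
    show "\<xi> = 0"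
    proof (rule ell2_eqI)
      fix k
      have "(cmod (coord \<xi> k))\<^sup>2 = 0"
        by (rule nonneg_infsum_le_0D[where A = UNIV and f = "\<lambda>k. (cmod (coord \<xi> k))\<^sup>2"])
          (use * in \<open>auto simp: inner_ell2_def Re_cinner_self coord_sq_summable\<close>)
      thus "coord \<xi> k = coord 0 k" by simp
    qed
  qed (simp add: inner_ell2_def Re_cinner_self)
qed (simp_all add: norm_ell2_def dist_ell2_def sgn_ell2_def uniformity_ell2_def open_ell2_def)

end

lemma norm_ell2_sq: "(norm \<xi>)\<^sup>2 = (\<Sum>\<^sub>\<infinity>k. (cmod (coord \<xi> k))\<^sup>2)"
  by (simp add: power2_norm_eq_inner inner_ell2_def Re_cinner_self)

lemma norm_cscale: "norm (cscale c \<xi>) = cmod c * norm \<xi>"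
proof -
  have "(norm (cscale c \<xi>))\<^sup>2 = (cmod c * norm \<xi>)\<^sup>2"
    by (simp add: norm_ell2_sq power_mult_distrib norm_mult infsum_cmult_right')
  thus ?thesis by (simp add: power2_eq_iff_nonneg)
qed


section \<open>Bounded operators\<close>

text \<open>
  Members of the type \<open>'k op\<close> are bounded and real-linear, with the operator norm; the bounded
  complex-linear operators, i.e. \<open>B(\<ell>\<^sup>2(K))\<close>, form the set \<open>bounded_ops\<close>.
\<close>

type_synonym 'k op = "'k ell2 \<Rightarrow>\<^sub>L 'k ell2"

definition bounded_ops :: "'k op set" where
  "bounded_ops = {T. \<forall>c \<xi>. blinfun_apply T (cscale c \<xi>) = cscale c (blinfun_apply T \<xi>)}"

definition scalar_op :: "complex \<Rightarrow> 'k op" where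
  "scalar_op c = Blinfun (cscale c)"

lemma scalar_op_apply [simp]:
  fixes \<xi> :: "'k ell2"
  shows "blinfun_apply (scalar_op c) \<xi> = cscale c \<xi>"
proof -
  have "bounded_linear (cscale c :: 'k ell2 \<Rightarrow> 'k ell2)"
    by (rule bounded_linear_intro[where K = "cmod c"])
      (auto intro!: ell2_eqI simp: algebra_simps norm_cscale)
  thus ?thesis by (simp add: scalar_op_def bounded_linear_Blinfun_apply)
qed

definition adj :: "'k op \<Rightarrow> 'k op" where
  "adj T = (THE S. \<forall>\<xi> \<eta>. cinner (blinfun_apply T \<xi>) \<eta> = cinner \<xi> (blinfun_apply S \<eta>))"

definition unital_cstar_algebra :: "'k op set \<Rightarrow> bool" where
  "unital_cstar_algebra A \<longleftrightarrow>
     A \<subseteq> bounded_ops \<and> closed A \<and> (\<forall>c. scalar_op c \<in> A) \<and>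
     (\<forall>a\<in>A. \<forall>b\<in>A. a + b \<in> A \<and> a o\<^sub>L b \<in> A) \<and> (\<forall>a\<in>A. adj a \<in> A)"

definition abelian_ops :: "'k op set \<Rightarrow> bool" where
  "abelian_ops A \<longleftrightarrow> (\<forall>a\<in>A. \<forall>b\<in>A. a o\<^sub>L b = b o\<^sub>L a)"

definition operator_system :: "'k op set \<Rightarrow> bool" where
  "operator_system S \<longleftrightarrow>
     S \<subseteq> bounded_ops \<and> scalar_op 1 \<in> S \<and> (\<forall>a\<in>S. \<forall>b\<in>S. a + b \<in> S) \<and>
     (\<forall>c. \<forall>a\<in>S. scalar_op c o\<^sub>L a \<in> S) \<and> (\<forall>a\<in>S. adj a \<in> S)"


section \<open>Completely positive maps\<close>

text \<open>
  Positivity of the \<open>n \<times> n\<close> operator matrix \<open>(A i j)\<close>, as an operator on the direct sum of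
  \<open>n\<close> copies of \<open>\<ell>\<^sup>2(K)\<close>.
\<close>
definition matrix_positive :: "nat \<Rightarrow> (nat \<Rightarrow> nat \<Rightarrow> 'k op) \<Rightarrow> bool" where
  "matrix_positive n A \<longleftrightarrow>
     (\<forall>\<xi> :: nat \<Rightarrow> 'k ell2.
        (\<Sum>i<n. \<Sum>j<n. cinner (blinfun_apply (A i j) (\<xi> j)) (\<xi> i)) \<in> \<real>\<^sub>\<ge>\<^sub>0)"

definition clinear_map_on :: "'k op set \<Rightarrow> ('k op \<Rightarrow> 'l op) \<Rightarrow> bool" where
  "clinear_map_on S \<phi> \<longleftrightarrow>
     (\<forall>a\<in>S. \<forall>b\<in>S. \<phi> (a + b) = \<phi> a + \<phi> b) \<and>
     (\<forall>c. \<forall>a\<in>S. \<phi> (scalar_op c o\<^sub>L a) = scalar_op c o\<^sub>L \<phi> a)"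

definition ucp :: "'k op set \<Rightarrow> 'l op set \<Rightarrow> ('k op \<Rightarrow> 'l op) \<Rightarrow> bool" where
  "ucp S T \<phi> \<longleftrightarrow>
     \<phi> ` S \<subseteq> T \<and> clinear_map_on S \<phi> \<and> \<phi> (scalar_op 1) = scalar_op 1 \<and>
     (\<forall>n A. (\<forall>i j. A i j \<in> S) \<longrightarrow> matrix_positive n A \<longrightarrow> matrix_positive n (\<lambda>i j. \<phi> (A i j)))"

text \<open>Complete order embeddings; for unital maps these are the complete isometries.\<close>
definition complete_order_embedding :: "'k op set \<Rightarrow> ('k op \<Rightarrow> 'l op) \<Rightarrow> bool" where
  "complete_order_embedding S \<phi> \<longleftrightarrow>
     (\<forall>n A. (\<forall>i j. A i j \<in> S) \<longrightarrow> (matrix_positive n A \<longleftrightarrow> matrix_positive n (\<lambda>i j. \<phi> (A i j))))"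

definition unital_star_hom :: "'k op set \<Rightarrow> 'l op set \<Rightarrow> ('k op \<Rightarrow> 'l op) \<Rightarrow> bool" where
  "unital_star_hom A B \<phi> \<longleftrightarrow>
     \<phi> ` A \<subseteq> B \<and> clinear_map_on A \<phi> \<and> \<phi> (scalar_op 1) = scalar_op 1 \<and>
     (\<forall>a\<in>A. \<forall>b\<in>A. \<phi> (a o\<^sub>L b) = \<phi> a o\<^sub>L \<phi> b) \<and> (\<forall>a\<in>A. \<phi> (adj a) = adj (\<phi> a))"


section \<open>Injective envelopes\<close>

text \<open>
  Injectivity in the category of operator systems and unital completely positive maps.  A
  formula cannot quantify over types, so the test objects \<open>S \<subseteq> T\<close> are operator systems on the
  Hilbert space \<open>H = \<ell>\<^sup>2(K)\<close> on which \<open>I\<close> acts.  This is no restriction: taking \<open>S = I\<close>,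
  \<open>T = B(H)\<close> gives a unital completely positive projection of \<open>B(H)\<close> onto \<open>I\<close>, so \<open>I\<close> inherits
  injectivity with respect to all operator systems from \<open>B(H)\<close> (Arveson).
\<close>
definition injective_system :: "'k op set \<Rightarrow> bool" where
  "injective_system I \<longleftrightarrow>
     (\<forall>(S :: 'k op set) (T :: 'k op set) \<phi>.
        operator_system S \<and> operator_system T \<and> S \<subseteq> T \<and> ucp S I \<phi> \<longrightarrow>
        (\<exists>\<psi>. ucp T I \<psi> \<and> (\<forall>s\<in>S. \<psi> s = \<phi> s)))"

definition rigid_extension :: "'k op set \<Rightarrow> 'l op set \<Rightarrow> ('k op \<Rightarrow> 'l op) \<Rightarrow> bool" where
  "rigid_extension B I \<iota> \<longleftrightarrow>
     (\<forall>\<phi>. ucp I I \<phi> \<and> (\<forall>b\<in>B. \<phi> (\<iota> b) = \<iota> b) \<longrightarrow> (\<forall>a\<in>I. \<phi> a = a))"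

text \<open>
  The targets of the test maps \<open>\<phi>\<close> are again restricted to the Hilbert space on which \<open>I\<close> acts.
  For a rigid extension with \<open>I\<close> injective this is no loss: if \<open>\<phi> \<circ> \<iota>\<close> is a complete order
  embedding into any operator system, its inverse followed by \<open>\<iota>\<close> extends to a map \<open>\<psi>\<close> into \<open>I\<close>,
  and \<open>\<psi> \<circ> \<phi>\<close> is the identity by rigidity.
\<close>
definition essential_extension :: "'k op set \<Rightarrow> 'l op set \<Rightarrow> ('k op \<Rightarrow> 'l op) \<Rightarrow> bool" where
  "essential_extension B I \<iota> \<longleftrightarrow>
     (\<forall>\<phi> :: 'l op \<Rightarrow> 'l op.
        ucp I bounded_ops \<phi> \<and> complete_order_embedding B (\<phi> \<circ> \<iota>) \<longrightarrow>
        complete_order_embedding I \<phi>)"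

definition injective_envelope :: "'k op set \<Rightarrow> 'l op set \<Rightarrow> ('k op \<Rightarrow> 'l op) \<Rightarrow> bool" where
  "injective_envelope B I \<iota> \<longleftrightarrow>
     unital_cstar_algebra I \<and> abelian_ops I \<and> injective_system I \<and>
     unital_star_hom B I \<iota> \<and> inj_on \<iota> B \<and> rigid_extension B I \<iota> \<and> essential_extension B I \<iota>"

text \<open>
  For a regular MASA inclusion \<open>B \<subseteq> C\<close> exactly one map (up to its values off \<open>C\<close>) is a
  pseudo-expectation, and \<open>left_kernel C E\<close> for this \<open>E\<close> is the ideal \<open>\<L>(C, B)\<close>.
\<close>
definition pseudo_expectation ::
    "'k op set \<Rightarrow> 'k op set \<Rightarrow> 'l op set \<Rightarrow> ('k op \<Rightarrow> 'l op) \<Rightarrow> ('k op \<Rightarrow> 'l op) \<Rightarrow> bool" where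
  "pseudo_expectation C B I \<iota> E \<longleftrightarrow> ucp C I E \<and> (\<forall>b\<in>B. E b = \<iota> b)"

definition left_kernel :: "'k op set \<Rightarrow> ('k op \<Rightarrow> 'l op) \<Rightarrow> 'k op set" where
  "left_kernel C E = {a \<in> C. E (adj a o\<^sub>L a) = 0}"

definition relative_commutant :: "'k op set \<Rightarrow> 'k op set \<Rightarrow> 'k op set" where
  "relative_commutant C D = {a \<in> C. \<forall>d\<in>D. a o\<^sub>L d = d o\<^sub>L a}"


section \<open>The reduced crossed product of a discrete group action\<close>

text \<open>
  Groups are types of class \<open>group_add\<close>, which does not assume commutativity: \<open>s + t\<close>, \<open>- s\<close> and
  \<open>0\<close> are the product, the inverse and the neutral element.
\<close>

definition continuous_action :: "('g::group_add \<Rightarrow> 'x::topological_space \<Rightarrow> 'x) \<Rightarrow> bool" where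
  "continuous_action act \<longleftrightarrow>
     (\<forall>x. act 0 x = x) \<and> (\<forall>s t x. act (s + t) x = act s (act t x)) \<and>
     (\<forall>s. homeomorphism UNIV UNIV (act s) (act (- s)))"

definition fixed_set :: "('g \<Rightarrow> 'x \<Rightarrow> 'x) \<Rightarrow> 'g \<Rightarrow> 'x set" where
  "fixed_set act s = {x. act s x = x}"

definition germ_isotropy :: "('g \<Rightarrow> 'x::topological_space \<Rightarrow> 'x) \<Rightarrow> 'x \<Rightarrow> 'g set" where
  "germ_isotropy act x = {s. x \<in> interior (fixed_set act s)}"

text \<open>
  The regular representation induced from the faithful representation of \<open>C(X)\<close> on \<open>\<ell>\<^sup>2(X)\<close> by
  multiplication, on \<open>\<ell>\<^sup>2(\<Gamma>, \<ell>\<^sup>2(X)) = \<ell>\<^sup>2(\<Gamma> \<times> X)\<close>: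
  \<open>(\<pi>(f) \<xi>)(s) = \<alpha>\<^bsub>-s\<^esub>(f) \<xi>(s)\<close>, where \<open>\<alpha>\<^bsub>-s\<^esub>(f)(x) = f(s x)\<close>, and \<open>(\<lambda>\<^sub>t \<xi>)(s) = \<xi>(-t + s)\<close>.
\<close>

definition mult_op :: "('g \<Rightarrow> 'x \<Rightarrow> 'x) \<Rightarrow> ('x \<Rightarrow> complex) \<Rightarrow> ('g \<times> 'x) op" where
  "mult_op act f = Blinfun (\<lambda>\<xi>. Abs_ell2 (\<lambda>(s, x). f (act s x) * coord \<xi> (s, x)))"

definition translation_op :: "'g::group_add \<Rightarrow> ('g \<times> 'x) op" where
  "translation_op t = Blinfun (\<lambda>\<xi>. Abs_ell2 (\<lambda>(s, x). coord \<xi> (- t + s, x)))"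

lemma coord_mult_op:
  fixes act :: "'g \<Rightarrow> 'x::topological_space \<Rightarrow> 'x"
  assumes "compact (UNIV :: 'x set)" "continuous_on UNIV f"
  shows "coord (blinfun_apply (mult_op act f) \<xi>) (s, x) = f (act s x) * coord \<xi> (s, x)"
proof -
  have "bounded (range f)"
    using assms compact_continuous_image compact_imp_bounded by blast
  then obtain M where M: "\<And>x. cmod (f x) \<le> M"
    by (auto simp: bounded_iff)
  hence M0: "0 \<le> M" using norm_ge_zero order_trans by blast
  define g where "g = (\<lambda>(s, x). f (act s x))"
  have g: "cmod (g k) \<le> M" for k by (simp add: g_def M split: prod.split)
  define F where "F \<xi> = Abs_ell2 (\<lambda>(s, x). f (act s x) * coord \<xi> (s, x))" for \<xi> :: "('g \<times> 'x) ell2"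
  have eq: "(\<lambda>(s, x). f (act s x) * coord \<xi> (s, x)) = (\<lambda>k. g k * coord \<xi> k)"
    for \<xi> :: "('g \<times> 'x) ell2"
    by (auto simp: g_def)
  have F: "coord (F \<xi>) = (\<lambda>k. g k * coord \<xi> k)" for \<xi>
    unfolding F_def eq
    by (rule Abs_ell2_inverse) (use sq_summable_mult_bounded[OF coord_sq_summable g] in simp)
  have "bounded_linear F"
  proof (rule bounded_linear_intro[where K = M])
    show "norm (F \<xi>) \<le> norm \<xi> * M" for \<xi>
    proof (rule power2_le_imp_le)
      have "(norm (F \<xi>))\<^sup>2 \<le> (\<Sum>\<^sub>\<infinity>k. M\<^sup>2 * (cmod (coord \<xi> k))\<^sup>2)"
        unfolding norm_ell2_sq
      proof (rule infsum_mono)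
        show "(cmod (coord (F \<xi>) k))\<^sup>2 \<le> M\<^sup>2 * (cmod (coord \<xi> k))\<^sup>2" for k
          unfolding F norm_mult power_mult_distrib
          by (intro mult_right_mono power_mono g) auto
      qed (intro coord_sq_summable summable_on_cmult_right)+
      thus "(norm (F \<xi>))\<^sup>2 \<le> (norm \<xi> * M)\<^sup>2"
        by (simp add: infsum_cmult_right' norm_ell2_sq[symmetric] power_mult_distrib mult.commute)
    qed (simp add: M0)
  qed (auto intro!: ell2_eqI simp: F algebra_simps)
  hence "blinfun_apply (mult_op act f) = F"
    unfolding mult_op_def F_def by (rule bounded_linear_Blinfun_apply)
  thus ?thesis by (simp add: F g_def)
qed

lemma coord_translation_op:
  fixes t :: "'g::group_add" and \<xi> :: "('g \<times> 'x) ell2"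
  shows "coord (blinfun_apply (translation_op t) \<xi>) (s, x) = coord \<xi> (- t + s, x)"
proof -
  define h where "h = (\<lambda>(s, x :: 'x). (- t + s, x))"
  have h: "bij_betw h UNIV UNIV"
    by (rule bij_betw_byWitness[where f' = "\<lambda>(s, x). (t + s, x)"])
      (auto simp: h_def simp flip: add.assoc)
  define F where "F \<xi> = Abs_ell2 (\<lambda>(s, x). coord \<xi> (- t + s, x))" for \<xi> :: "('g \<times> 'x) ell2"
  have eq: "(\<lambda>(s, x). coord \<xi> (- t + s, x)) = (\<lambda>k. coord \<xi> (h k))" for \<xi> :: "('g \<times> 'x) ell2"
    by (auto simp: h_def)
  have F: "coord (F \<xi>) = (\<lambda>k. coord \<xi> (h k))" for \<xi>
    unfolding F_def eq
    by (rule Abs_ell2_inverse)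
      (use summable_on_reindex_bij_betw[OF h, of "\<lambda>k. (cmod (coord \<xi> k))\<^sup>2"]
        coord_sq_summable[of \<xi>] in simp)
  have "(norm (F \<xi>))\<^sup>2 = (norm \<xi>)\<^sup>2" for \<xi>
    unfolding norm_ell2_sq F
    by (rule infsum_reindex_bij_betw[OF h, of "\<lambda>k. (cmod (coord \<xi> k))\<^sup>2"])
  hence "norm (F \<xi>) = norm \<xi>" for \<xi>
    by (simp add: power2_eq_iff_nonneg)
  hence "bounded_linear F"
    by (intro bounded_linear_intro[where K = 1]) (auto intro!: ell2_eqI simp: F)
  hence "blinfun_apply (translation_op t) = F"
    unfolding translation_op_def F_def by (rule bounded_linear_Blinfun_apply)
  thus ?thesis by (simp add: F h_def)
qed

definition function_algebra ::
    "('g \<Rightarrow> 'x::topological_space \<Rightarrow> 'x) \<Rightarrow> ('g \<times> 'x) op set" where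
  "function_algebra act = {mult_op act f | f. continuous_on UNIV f}"

text \<open>
  The real span below is a complex subspace, as \<open>C(X)\<close> is one; it is the image of the algebra
  \<open>C\<^sub>c(\<Gamma>, C(X))\<close> of finite sums \<open>\<Sum>\<^sub>t f\<^sub>t \<lambda>\<^sub>t\<close>.
\<close>
definition reduced_crossed_product ::
    "('g::group_add \<Rightarrow> 'x::topological_space \<Rightarrow> 'x) \<Rightarrow> ('g \<times> 'x) op set" where
  "reduced_crossed_product act =
     closure (span {mult_op act f o\<^sub>L translation_op t | f t. continuous_on UNIV f})"

end

theory Submission
  imports Defs
begin

text \<open>
  For \<open>a\<^sub>0\<close> in the left kernel put \<open>a = a\<^sub>0\<^sup>* a\<^sub>0\<close>, so that \<open>E(a) = 0\<close>, and suppose that \<open>a\<close> has a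
  nonzero diagonal entry.  A nearby self-adjoint finite sum \<open>a' = \<Sum>\<^sub>t f\<^sub>t \<lambda>\<^sub>t\<close> then has its
  coefficient \<open>f\<^sub>0\<close> bounded below on a nonempty open set, which can be shrunk to a set \<open>W\<close> such that
  each of the finitely many \<open>t\<close> involved fixes every point of \<open>W\<close> that it does not move out of \<open>W\<close>.
  For a bump function \<open>h\<close> supported in \<open>W\<close> this puts \<open>b = h a' h\<close> into \<open>\<D>\<^sup>c\<close>.  As \<open>\<D>\<close> lies in the
  multiplicative domain of \<open>E\<close>, \<open>E(h a h) = 0\<close>, and \<open>b \<le> h a h + \<epsilon>\<close> gives \<open>\<iota>(b) \<le> \<epsilon>\<close>.  An injective
  *-homomorphism reflects positivity, so \<open>b \<le> \<epsilon>\<close>, contradicting the lower bound on \<open>f\<^sub>0\<close>.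
\<close>

section \<open>Hilbert space preliminaries\<close>

lemma cinner_simps:
  "cinner 0 \<eta> = 0" "cinner \<xi> 0 = 0"
  "cinner (- \<xi>) \<eta> = - cinner \<xi> \<eta>" "cinner \<xi> (- \<eta>) = - cinner \<xi> \<eta>"
  "cinner (\<xi> + \<xi>') \<eta> = cinner \<xi> \<eta> + cinner \<xi>' \<eta>" "cinner \<xi> (\<eta> + \<eta>') = cinner \<xi> \<eta> + cinner \<xi> \<eta>'"
  "cinner (\<xi> - \<xi>') \<eta> = cinner \<xi> \<eta> - cinner \<xi>' \<eta>" "cinner \<xi> (\<eta> - \<eta>') = cinner \<xi> \<eta> - cinner \<xi> \<eta>'"
  "cinner (cscale c \<xi>) \<eta> = c * cinner \<xi> \<eta>" "cinner \<xi> (cscale c \<eta>) = cnj c * cinner \<xi> \<eta>"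
  "cinner (r *\<^sub>R \<xi>) \<eta> = r * cinner \<xi> \<eta>" "cinner \<xi> (r *\<^sub>R \<eta>) = r * cinner \<xi> \<eta>"
proof -
  have neg: "- \<xi> = cscale (- 1) \<xi>" for \<xi> :: "'a ell2"
    by (rule ell2_eqI) simp
  have addr: "cinner \<xi> (\<eta> + \<eta>') = cinner \<xi> \<eta> + cinner \<xi> \<eta>'" for \<xi> \<eta> \<eta>' :: "'a ell2"
    by (metis cinner_add_left cinner_commute complex_cnj_add)
  have scr: "cinner \<xi> (cscale c \<eta>) = cnj c * cinner \<xi> \<eta>" for \<xi> \<eta> :: "'a ell2" and c
    by (metis cinner_cscale_left cinner_commute complex_cnj_mult)
  show "cinner 0 \<eta> = 0" "cinner \<xi> 0 = 0"
    by (simp_all add: cinner_def)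
  show "cinner (\<xi> + \<xi>') \<eta> = cinner \<xi> \<eta> + cinner \<xi>' \<eta>" "cinner (cscale c \<xi>) \<eta> = c * cinner \<xi> \<eta>"
    by (fact cinner_add_left cinner_cscale_left)+
  show "cinner \<xi> (\<eta> + \<eta>') = cinner \<xi> \<eta> + cinner \<xi> \<eta>'" "cinner \<xi> (cscale c \<eta>) = cnj c * cinner \<xi> \<eta>"
    by (fact addr scr)+
  show "cinner (- \<xi>) \<eta> = - cinner \<xi> \<eta>" "cinner \<xi> (- \<eta>) = - cinner \<xi> \<eta>"
    by (simp_all add: neg cinner_cscale_left scr)
  show "cinner (\<xi> - \<xi>') \<eta> = cinner \<xi> \<eta> - cinner \<xi>' \<eta>" "cinner \<xi> (\<eta> - \<eta>') = cinner \<xi> \<eta> - cinner \<xi> \<eta>'"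
    unfolding diff_conv_add_uminus addr cinner_add_left neg
    by (simp_all add: cinner_cscale_left scr)
  show "cinner (r *\<^sub>R \<xi>) \<eta> = r * cinner \<xi> \<eta>" "cinner \<xi> (r *\<^sub>R \<eta>) = r * cinner \<xi> \<eta>"
    by (simp_all add: scaleR_eq_cscale cinner_cscale_left scr)
qed

lemma cscale_simps [simp]:
  "cscale c (\<xi> + \<eta>) = cscale c \<xi> + cscale c \<eta>" "cscale c (\<xi> - \<eta>) = cscale c \<xi> - cscale c \<eta>"
  "cscale c (- \<xi>) = - cscale c \<xi>" "cscale c 0 = 0" "cscale c (r *\<^sub>R \<xi>) = r *\<^sub>R cscale c \<xi>"
  "cscale c (cscale d \<xi>) = cscale (c * d) \<xi>" "cscale 1 \<xi> = \<xi>"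
  by (auto intro!: ell2_eqI simp: algebra_simps)

lemma bounded_linear_cscale: "bounded_linear (cscale c)"
  by (rule bounded_linear_intro[where K = "cmod c"])
      (simp_all add: norm_cscale scaleR_eq_cscale ell2_eqI distrib_right mult.commute)

lemma cinner_self: "cinner \<xi> \<xi> = complex_of_real ((norm \<xi>)\<^sup>2)"
proof -
  have "cinner \<xi> \<xi> = cnj (cinner \<xi> \<xi>)"
    by (rule cinner_commute)
  hence "Im (cinner \<xi> \<xi>) = 0"
    by (metis complex_cnj_cancel_iff Reals_cnj_iff complex_is_Real_iff)
  thus ?thesis
    by (simp add: complex_eq_iff power2_norm_eq_inner inner_ell2_def)
qed

text \<open>A unimodular scalar \<open>c\<close> rotates the inner product onto the nonnegative real
  axis, where the real Cauchy-Schwarz inequality applies.\<close>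

lemma cmod_cinner_le: "cmod (cinner \<xi> \<eta>) \<le> norm \<xi> * norm \<eta>"
proof (cases "cinner \<xi> \<eta> = 0")
  case False
  define c where "c = cnj (sgn (cinner \<xi> \<eta>))"
  have c: "cmod c = 1" "c * cinner \<xi> \<eta> = cmod (cinner \<xi> \<eta>)"
  proof -
    show "cmod c = 1" using False by (simp add: c_def norm_sgn)
    have "cnj (cinner \<xi> \<eta>) * cinner \<xi> \<eta> = complex_of_real (cmod (cinner \<xi> \<eta>)) * cmod (cinner \<xi> \<eta>)"
      using complex_norm_square[of "cinner \<xi> \<eta>"] by (simp add: power2_eq_square mult.commute)
    thus "c * cinner \<xi> \<eta> = cmod (cinner \<xi> \<eta>)"
      using False by (simp add: c_def sgn_div_norm scaleR_conv_of_real divide_simps)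
  qed
  have "cmod (cinner \<xi> \<eta>) = inner (cscale c \<xi>) \<eta>"
    by (simp add: inner_ell2_def cinner_simps c)
  also have "\<dots> \<le> norm (cscale c \<xi>) * norm \<eta>"
    by (rule norm_cauchy_schwarz)
  finally show ?thesis by (simp add: norm_cscale c)
qed auto

lemma cinner_eqI: "(\<And>\<zeta>. cinner \<xi> \<zeta> = cinner \<eta> \<zeta>) \<Longrightarrow> \<xi> = \<eta>"
proof -
  assume "\<And>\<zeta>. cinner \<xi> \<zeta> = cinner \<eta> \<zeta>"
  hence "cinner (\<xi> - \<eta>) (\<xi> - \<eta>) = 0" by (simp add: cinner_simps)
  thus ?thesis by (simp add: cinner_self)
qed

section \<open>Standard basis vectors and expansions\<close>

lift_definition ket :: "'k \<Rightarrow> 'k ell2" is "\<lambda>k j. if j = k then 1 else 0"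
  by (rule summable_on_cong_neutral[where S = "{_}", THEN iffD1]) auto

lemma coord_ket [simp]: "coord (ket k) j = (if j = k then 1 else 0)"
  by transfer simp

lemma cinner_ket [simp]: "cinner \<xi> (ket k) = coord \<xi> k"
proof -
  have "(\<Sum>\<^sub>\<infinity>j. coord \<xi> j * cnj (coord (ket k) j)) = (\<Sum>\<^sub>\<infinity>j\<in>{k}. coord \<xi> j)"
    by (rule infsum_cong_neutral) auto
  thus ?thesis by (simp add: cinner_def)
qed

lemma norm_ket [simp]: "norm (ket k) = 1"
proof -
  have "complex_of_real ((norm (ket k))\<^sup>2) = 1"
    unfolding cinner_self[symmetric] by simp
  hence "(norm (ket k))\<^sup>2 = 1"
    using of_real_eq_1_iff by blast
  thus ?thesis using norm_ge_zero[of "ket k"] unfolding power2_eq_1_iff by linarith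
qed

lemma coord_sum: "coord (\<Sum>a\<in>A. f a) k = (\<Sum>a\<in>A. coord (f a) k)"
  by (induction A rule: infinite_finite_induct) auto

lemma sum_sq_coord_le: "finite F \<Longrightarrow> (\<Sum>k\<in>F. (cmod (coord \<xi> k))\<^sup>2) \<le> (norm \<xi>)\<^sup>2"
  unfolding norm_ell2_sq by (rule finite_sum_le_infsum) (auto simp: coord_sq_summable)

text \<open>By orthogonality the squared error of a finite partial sum is \<open>g F\<close>, the
  share of the squared norm carried outside \<open>F\<close>, which tends to zero.\<close>

lemma ket_expansion: "((\<lambda>k. cscale (coord \<xi> k) (ket k)) has_sum \<xi>) UNIV"
  unfolding has_sum_def
proof (rule Lim_null[THEN iffD2], rule tendsto_norm_zero_cancel)
  define g where "g F = (norm \<xi>)\<^sup>2 - (\<Sum>k\<in>F. (cmod (coord \<xi> k))\<^sup>2)" for F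
  let ?P = "\<lambda>F. (\<Sum>k\<in>F. cscale (coord \<xi> k) (ket k))"
  have sq: "(norm (?P F - \<xi>))\<^sup>2 = g F" if "finite F" for F
  proof -
    have P: "coord (?P F) k = (if k \<in> F then coord \<xi> k else 0)" for k
      using that by (simp add: coord_sum sum.delta' if_distrib cong: if_cong)
    have "(\<lambda>k. - (cmod (coord \<xi> k))\<^sup>2) summable_on F"
      using that by (rule summable_on_finite)
    also have "?this \<longleftrightarrow> (\<lambda>k. - (if k \<in> F then (cmod (coord \<xi> k))\<^sup>2 else 0)) summable_on UNIV"
      by (rule summable_on_cong_neutral) auto
    finally have summ: "(\<lambda>k. - (if k \<in> F then (cmod (coord \<xi> k))\<^sup>2 else 0)) summable_on UNIV" .
    have "(norm (?P F - \<xi>))\<^sup>2 = (\<Sum>\<^sub>\<infinity>k. (cmod (coord \<xi> k))\<^sup>2 - (if k \<in> F then (cmod (coord \<xi> k))\<^sup>2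
        else 0))"
      unfolding norm_ell2_sq by (rule infsum_cong) (simp add: P)
    also have "\<dots> = (norm \<xi>)\<^sup>2 + (\<Sum>\<^sub>\<infinity>k. - (if k \<in> F then (cmod (coord \<xi> k))\<^sup>2 else 0))"
      unfolding norm_ell2_sq diff_conv_add_uminus
      by (rule infsum_add[OF coord_sq_summable summ])
    also have "(\<Sum>\<^sub>\<infinity>k. - (if k \<in> F then (cmod (coord \<xi> k))\<^sup>2 else 0)) =
        (\<Sum>\<^sub>\<infinity>k\<in>F. - (cmod (coord \<xi> k))\<^sup>2)"
      by (rule infsum_cong_neutral) auto
    finally show ?thesis
      using that by (simp add: g_def sum_negf)
  qed
  have "(g \<longlongrightarrow> (norm \<xi>)\<^sup>2 - (norm \<xi>)\<^sup>2) (finite_subsets_at_top UNIV)"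
    unfolding g_def norm_ell2_sq
    by (intro tendsto_diff tendsto_const)
        (use has_sum_infsum[OF coord_sq_summable] in \<open>simp add: has_sum_def\<close>)
  hence "((\<lambda>F. sqrt (g F)) \<longlongrightarrow> 0) (finite_subsets_at_top UNIV)"
    using tendsto_real_sqrt by fastforce
  moreover have "\<forall>\<^sub>F F in finite_subsets_at_top UNIV. sqrt (g F) = norm (?P F - \<xi>)"
    by (rule eventually_finite_subsets_at_top_weakI) (simp flip: sq)
  ultimately show "((\<lambda>F. norm (?P F - \<xi>)) \<longlongrightarrow> 0) (finite_subsets_at_top UNIV)"
    by (rule Lim_transform_eventually)
qed

lemma blinfun_ket_expansion:
  assumes "T \<in> bounded_ops"
  shows "((\<lambda>k. cscale (coord \<xi> k) (blinfun_apply T (ket k))) has_sum blinfun_apply T \<xi>) UNIV"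
proof -
  have "((\<lambda>F. blinfun_apply T (\<Sum>k\<in>F. cscale (coord \<xi> k) (ket k)))
      \<longlongrightarrow> blinfun_apply T \<xi>) (finite_subsets_at_top UNIV)"
    using ket_expansion[of \<xi>] unfolding has_sum_def
    by (rule bounded_linear.tendsto[OF blinfun.bounded_linear_right])
  thus ?thesis
    using assms by (simp add: has_sum_def blinfun.sum_right bounded_ops_def)
qed

section \<open>Completeness and existence of adjoints\<close>

lemma bounded_linear_cinner_left: "bounded_linear (\<lambda>\<xi>. cinner \<xi> \<eta>)"
  by (rule bounded_linear_intro[where K = "norm \<eta>"])
      (auto simp: cinner_simps cmod_cinner_le scaleR_conv_of_real)

text \<open>Completeness passes to the space of operators and lets the square root iteration below
  converge there.\<close>

instance ell2 :: (type) banach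
proof
  fix X :: "nat \<Rightarrow> 'a ell2"
  assume X: "Cauchy X"
  have "Cauchy (\<lambda>n. coord (X n) k)" for k
    using bounded_linear.Cauchy[OF bounded_linear_cinner_left X, of "ket k"] by simp
  hence "\<exists>f. \<forall>k. (\<lambda>n. coord (X n) k) \<longlonglongrightarrow> f k"
    by (intro choice allI) (auto simp: Cauchy_convergent_iff convergent_def)
  then obtain f where f: "\<And>k. (\<lambda>n. coord (X n) k) \<longlonglongrightarrow> f k" by blast
  \<comment> \<open>One estimate on finite sums serves twice: with \<eta> = 0 it makes the
    coordinatewise limit square summable, and with \<eta> = \<open>X n\<close> it gives convergence
    in norm.\<close>
  have bd: "(\<Sum>k\<in>F. (cmod (f k - coord \<eta> k))\<^sup>2) \<le> e\<^sup>2"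
    if "finite F" "\<And>n. n \<ge> N \<Longrightarrow> norm (X n - \<eta>) \<le> e" for F N \<eta> e
  proof (rule LIMSEQ_le_const2)
    show "(\<lambda>n. \<Sum>k\<in>F. (cmod (coord (X n) k - coord \<eta> k))\<^sup>2) \<longlonglongrightarrow> (\<Sum>k\<in>F. (cmod (f k - coord \<eta> k))\<^sup>2)"
      by (intro tendsto_intros f)
    have "(\<Sum>k\<in>F. (cmod (coord (X n) k - coord \<eta> k))\<^sup>2) \<le> e\<^sup>2" if "n \<ge> N" for n
      using sum_sq_coord_le[OF \<open>finite F\<close>, of "X n - \<eta>"] power_mono[OF \<open>\<And>n. n \<ge> N \<Longrightarrow>
          norm (X n - \<eta>) \<le> e\<close>[OF that], of 2]
      by simp
    thus "\<exists>N. \<forall>n\<ge>N. (\<Sum>k\<in>F. (cmod (coord (X n) k - coord \<eta> k))\<^sup>2) \<le> e\<^sup>2" by blast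
  qed
  obtain B where B: "\<And>n. norm (X n) \<le> B"
    using Cauchy_Bseq[OF X] by (auto simp: Bseq_def)
  have "(\<lambda>k. (cmod (f k))\<^sup>2) summable_on UNIV"
  proof (rule nonneg_bounded_partial_sums_imp_summable_on)
    show "\<forall>\<^sub>F F in finite_subsets_at_top UNIV. (\<Sum>k\<in>F. (cmod (f k))\<^sup>2) \<le> B\<^sup>2"
      using bd[where \<eta> = 0 and N = 0] B by (intro eventually_finite_subsets_at_top_weakI) auto
  qed auto
  then obtain \<xi> where \<xi>: "coord \<xi> = f"
    by (metis Abs_ell2_inverse mem_Collect_eq)
  have "X \<longlonglongrightarrow> \<xi>"
  proof (rule metric_LIMSEQ_I)
    fix r :: real assume "r > 0"
    then obtain N where N: "\<And>m n. m \<ge> N \<Longrightarrow> n \<ge> N \<Longrightarrow> dist (X m) (X n) < r / 2"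
      using X by (meson Cauchy_def half_gt_zero)
    have "norm (\<xi> - X n) \<le> r / 2" if "n \<ge> N" for n
    proof (rule power2_le_imp_le)
      show "(norm (\<xi> - X n))\<^sup>2 \<le> (r / 2)\<^sup>2"
        unfolding norm_ell2_sq
      proof (rule infsum_le_finite_sums[OF coord_sq_summable])
        show "(\<Sum>k\<in>F. (cmod (coord (\<xi> - X n) k))\<^sup>2) \<le> (r / 2)\<^sup>2" if "finite F" for F
          using bd[OF that, of N "X n" "r / 2"] N[OF _ \<open>n \<ge> N\<close>]
          by (simp add: \<xi> dist_norm less_imp_le)
      qed
    qed (use \<open>r > 0\<close> in simp)
    thus "\<exists>N. \<forall>n\<ge>N. dist (X n) \<xi> < r"
      using \<open>r > 0\<close> by (intro exI[of _ N]) (force simp: dist_norm norm_minus_commute)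
  qed
  thus "convergent X" by (auto simp: convergent_def)
qed

text \<open>The coordinates \<open>g \<eta> k\<close> of the adjoint at \<eta> are forced. Testing
  \<open>T\<close> on a finite truncation \<xi> of them bounds the square of norm \<xi> by norm
  \<open>T\<close> times norm \<xi> times norm \<eta>, so the partial sums of squares are bounded
  uniformly in \<open>F\<close>.\<close>

lemma adj_exists:
  assumes T: "T \<in> bounded_ops"
  obtains S where "S \<in> bounded_ops" "norm S \<le> norm T"
    "\<And>\<xi> \<eta>. cinner (blinfun_apply T \<xi>) \<eta> = cinner \<xi> (blinfun_apply S \<eta>)"
proof -
  define g where "g \<eta> k = cinner \<eta> (blinfun_apply T (ket k))" for \<eta> k
  have part: "(\<Sum>k\<in>F. (cmod (g \<eta> k))\<^sup>2) \<le> (norm T * norm \<eta>)\<^sup>2" if F: "finite F" for F \<eta>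
  proof -
    define \<xi> where "\<xi> = (\<Sum>k\<in>F. cscale (g \<eta> k) (ket k))"
    have "coord \<xi> k = (if k \<in> F then g \<eta> k else 0)" for k
      using F by (simp add: \<xi>_def coord_sum sum.delta' if_distrib cong: if_cong)
    hence "(norm \<xi>)\<^sup>2 = (\<Sum>\<^sub>\<infinity>k\<in>F. (cmod (g \<eta> k))\<^sup>2)"
      unfolding norm_ell2_sq by (intro infsum_cong_neutral) auto
    hence n: "(norm \<xi>)\<^sup>2 = (\<Sum>k\<in>F. (cmod (g \<eta> k))\<^sup>2)" using F by simp
    have "cinner (blinfun_apply T \<xi>) \<eta> = (\<Sum>k\<in>F. g \<eta> k * cinner (blinfun_apply T (ket k)) \<eta>)"
      unfolding \<xi>_def blinfun.sum_right linear_sum[OF bounded_linear.linear[OF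
          bounded_linear_cinner_left]]
      using T by (simp add: bounded_ops_def cinner_simps)
    also have "\<dots> = (\<Sum>k\<in>F. complex_of_real ((cmod (g \<eta> k))\<^sup>2))"
    proof (rule sum.cong[OF refl])
      show "g \<eta> k * cinner (blinfun_apply T (ket k)) \<eta> = complex_of_real ((cmod (g \<eta> k))\<^sup>2)" for k
        using cinner_commute[of "blinfun_apply T (ket k)" \<eta>]
        by (simp add: g_def complex_norm_square[symmetric] flip: of_real_power)
    qed
    also have "\<dots> = complex_of_real ((norm \<xi>)\<^sup>2)"
      by (simp add: n)
    finally have "(norm \<xi>)\<^sup>2 \<le> norm (blinfun_apply T \<xi>) * norm \<eta>"
      using cmod_cinner_le[of "blinfun_apply T \<xi>" \<eta>] by (simp add: norm_power)
    also have "\<dots> \<le> norm T * norm \<xi> * norm \<eta>"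
      by (intro mult_right_mono norm_blinfun) auto
    finally have "norm \<xi> \<le> norm T * norm \<eta>"
      by (cases "norm \<xi> = 0") (auto simp: power2_eq_square mult_ac)
    thus ?thesis unfolding n[symmetric] by (intro power_mono) auto
  qed
  have summ: "(\<lambda>k. (cmod (g \<eta> k))\<^sup>2) summable_on UNIV" for \<eta>
    by (rule nonneg_bounded_partial_sums_imp_summable_on[where C = "(norm T * norm \<eta>)\<^sup>2"])
      (auto intro!: eventually_finite_subsets_at_top_weakI part)
  define G where "G \<eta> = Abs_ell2 (g \<eta>)" for \<eta>
  have G: "coord (G \<eta>) k = g \<eta> k" for \<eta> k
    unfolding G_def by (subst Abs_ell2_inverse) (use summ in auto)
  have Gn: "norm (G \<eta>) \<le> norm \<eta> * norm T" for \<eta>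
  proof (rule power2_le_imp_le)
    show "(norm (G \<eta>))\<^sup>2 \<le> (norm \<eta> * norm T)\<^sup>2"
      unfolding norm_ell2_sq
      by (rule infsum_le_finite_sums[OF coord_sq_summable])
          (use part in \<open>auto simp: G mult.commute\<close>)
  qed auto
  have bl: "bounded_linear G"
    by (rule bounded_linear_intro[OF _ _ Gn]) (auto intro!: ell2_eqI simp: G g_def cinner_simps)
  hence GB: "blinfun_apply (Blinfun G) = G" by (rule bounded_linear_Blinfun_apply)
  have "cinner (blinfun_apply T \<xi>) \<eta> = cinner \<xi> (G \<eta>)" for \<xi> \<eta>
  proof -
    have "((\<lambda>k. cinner (cscale (coord \<xi> k) (blinfun_apply T (ket k))) \<eta>)
        has_sum cinner (blinfun_apply T \<xi>) \<eta>) UNIV"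
      using has_sum_bounded_linear[OF bounded_linear_cinner_left blinfun_ket_expansion[OF T]]
      by (simp add: o_def)
    moreover have "((\<lambda>k. coord \<xi> k * cnj (coord (G \<eta>) k)) has_sum cinner \<xi> (G \<eta>)) UNIV"
      unfolding cinner_def by (rule has_sum_infsum[OF cinner_summable])
    moreover have "cinner (cscale (coord \<xi> k) (blinfun_apply T (ket k))) \<eta> =
        coord \<xi> k * cnj (coord (G \<eta>) k)" for k
      unfolding cinner_simps G g_def by (simp flip: cinner_commute)
    ultimately show ?thesis by (metis (no_types, lifting) has_sum_cong has_sum_unique)
  qed
  moreover have "Blinfun G \<in> bounded_ops"
    by (auto intro!: ell2_eqI simp: bounded_ops_def GB G g_def cinner_simps)
  moreover have "norm (Blinfun G) \<le> norm T"
    by (rule norm_blinfun_bound) (use Gn in \<open>auto simp: GB mult.commute\<close>)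
  ultimately show thesis using that[of "Blinfun G"] by (simp add: GB)
qed

text \<open>The definite description in \<open>adj\<close> needs uniqueness; with it, adjoints can
  be computed by checking an identity of inner products.\<close>

lemma adj_eqI:
  assumes "\<And>\<xi> \<eta>. cinner (blinfun_apply T \<xi>) \<eta> = cinner \<xi> (blinfun_apply S \<eta>)"
  shows "adj T = S"
  unfolding adj_def
proof (rule the_equality)
  fix S' assume S': "\<forall>\<xi> \<eta>. cinner (blinfun_apply T \<xi>) \<eta> = cinner \<xi> (blinfun_apply S' \<eta>)"
  show "S' = S"
  proof (rule blinfun_eqI, rule cinner_eqI)
    show "cinner (blinfun_apply S' \<eta>) \<zeta> = cinner (blinfun_apply S \<eta>) \<zeta>" for \<eta> \<zeta>
      using S' assms by (metis cinner_commute)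
  qed
qed (use assms in blast)

lemma
  assumes "T \<in> bounded_ops"
  shows cinner_adj_right: "cinner \<xi> (blinfun_apply (adj T) \<eta>) = cinner (blinfun_apply T \<xi>) \<eta>"
    and cinner_adj_left: "cinner (blinfun_apply (adj T) \<eta>) \<xi> = cinner \<eta> (blinfun_apply T \<xi>)"
    and adj_bounded_ops: "adj T \<in> bounded_ops"
    and norm_adj_le: "norm (adj T) \<le> norm T"
proof -
  obtain S where S: "S \<in> bounded_ops" "norm S \<le> norm T"
    "\<And>\<xi> \<eta>. cinner (blinfun_apply T \<xi>) \<eta> = cinner \<xi> (blinfun_apply S \<eta>)"
    using adj_exists[OF assms] by metis
  have [simp]: "adj T = S" by (rule adj_eqI[OF S(3)])
  show "cinner \<xi> (blinfun_apply (adj T) \<eta>) = cinner (blinfun_apply T \<xi>) \<eta>" for \<xi> \<eta>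
    by (simp add: S)
  thus "cinner (blinfun_apply (adj T) \<eta>) \<xi> = cinner \<eta> (blinfun_apply T \<xi>)"
    by (metis cinner_commute)
  show "adj T \<in> bounded_ops" "norm (adj T) \<le> norm T" using S by auto
qed

section \<open>Adjoints and positive operators\<close>

lemma bounded_opsD: "T \<in> bounded_ops \<Longrightarrow> blinfun_apply T (cscale c \<xi>) = cscale c (blinfun_apply T \<xi>)"
  by (simp add: bounded_ops_def)

lemma scalar_op_1: "scalar_op 1 = id_blinfun"
  by (rule blinfun_eqI) simp

lemma scalar_op_of_real: "scalar_op (complex_of_real r) o\<^sub>L a = r *\<^sub>R a"
  by (rule blinfun_eqI) (simp add: scaleR_eq_cscale scaleR_blinfun.rep_eq)

lemmas blinfun_rep = plus_blinfun.rep_eq minus_blinfun.rep_eq uminus_blinfun.rep_eq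
  scaleR_blinfun.rep_eq zero_blinfun.rep_eq

lemma bounded_ops_intros [intro]:
  "0 \<in> bounded_ops" "scalar_op c \<in> bounded_ops"
  "a \<in> bounded_ops \<Longrightarrow> b \<in> bounded_ops \<Longrightarrow> a + b \<in> bounded_ops"
  "a \<in> bounded_ops \<Longrightarrow> b \<in> bounded_ops \<Longrightarrow> a - b \<in> bounded_ops"
  "a \<in> bounded_ops \<Longrightarrow> b \<in> bounded_ops \<Longrightarrow> a o\<^sub>L b \<in> bounded_ops"
  "a \<in> bounded_ops \<Longrightarrow> r *\<^sub>R a \<in> bounded_ops"
  by (auto simp: bounded_ops_def blinfun_rep mult.commute)

lemma closed_bounded_ops: "closed bounded_ops"
proof -
  have "bounded_ops = (\<Inter>c. \<Inter>\<xi>. {T. blinfun_apply T (cscale c \<xi>) = cscale c (blinfun_apply T \<xi>)})"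
    by (auto simp: bounded_ops_def)
  also have "closed \<dots>"
    by (intro closed_INT ballI closed_Collect_eq
        bounded_linear.continuous_on[OF bounded_linear_cscale]
        bounded_linear.continuous_on[OF blinfun.bounded_linear_left] continuous_on_id)
  finally show ?thesis .
qed

lemma
  assumes "a \<in> bounded_ops" "b \<in> bounded_ops"
  shows adj_plus: "adj (a + b) = adj a + adj b"
    and adj_minus: "adj (a - b) = adj a - adj b"
    and adj_compose: "adj (a o\<^sub>L b) = adj b o\<^sub>L adj a"
  by (rule adj_eqI; simp add: blinfun_rep cinner_simps cinner_adj_right assms)+

lemma adj_scaleR: "a \<in> bounded_ops \<Longrightarrow> adj (r *\<^sub>R a) = r *\<^sub>R adj a"
  by (rule adj_eqI) (simp add: blinfun_rep cinner_simps cinner_adj_right)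

lemma adj_adj: "a \<in> bounded_ops \<Longrightarrow> adj (adj a) = a"
  by (rule adj_eqI) (simp add: cinner_adj_left)

lemma adj_id: "adj id_blinfun = id_blinfun"
  by (rule adj_eqI) simp

lemma adj_0: "adj 0 = 0"
  by (rule adj_eqI) (simp add: cinner_simps)

lemma selfadjoint_cinner:
  "a \<in> bounded_ops \<Longrightarrow> adj a = a \<Longrightarrow> cinner (blinfun_apply a \<xi>) \<eta> = cinner \<xi> (blinfun_apply a \<eta>)"
  by (metis cinner_adj_right)

lemma tendsto_adj:
  assumes "X \<longlonglongrightarrow> a" "\<And>n. X n \<in> bounded_ops" "a \<in> bounded_ops"
  shows "(\<lambda>n. adj (X n)) \<longlonglongrightarrow> adj a"
proof (rule Lim_null[THEN iffD2], rule tendsto_norm_zero_cancel, rule Lim_null_comparison)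
  show "(\<lambda>n. norm (X n - a)) \<longlonglongrightarrow> 0"
    using assms(1) Lim_null tendsto_norm_zero by blast
  show "\<forall>\<^sub>F n in sequentially. norm (norm (adj (X n) - adj a)) \<le> norm (X n - a)"
  proof (rule eventuallyI)
    show "norm (norm (adj (X n) - adj a)) \<le> norm (X n - a)" for n
      using norm_adj_le[of "X n - a"] by (simp add: adj_minus assms(2,3) bounded_ops_intros)
  qed
qed

text \<open>Polarization: the form at \<xi> + \<eta> gives the sum of the two cross terms, and
  replacing \<eta> by i \<eta> gives their difference.\<close>

lemma quadratic_form_zero:
  assumes T: "T \<in> bounded_ops" and z: "\<And>\<xi>. cinner (blinfun_apply T \<xi>) \<xi> = 0"
  shows "T = 0"
proof (rule blinfun_eqI, rule cinner_eqI)
  fix \<xi> \<eta>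
  have 1: "cinner (blinfun_apply T \<xi>) \<eta> + cinner (blinfun_apply T \<eta>) \<xi> = 0" for \<eta>
    using z[of "\<xi> + \<eta>"] z[of \<xi>] z[of \<eta>] by (simp add: blinfun.add_right cinner_simps add.commute)
  have "\<i> * (cinner (blinfun_apply T \<eta>) \<xi> - cinner (blinfun_apply T \<xi>) \<eta>) = 0"
    using 1[of "cscale \<i> \<eta>"] by (simp add: bounded_opsD[OF T] cinner_simps algebra_simps)
  thus "cinner (blinfun_apply T \<xi>) \<eta> = cinner (blinfun_apply 0 \<xi>) \<eta>"
    using 1[of \<eta>] by (simp add: cinner_simps)
qed

definition positive_op :: "'k op \<Rightarrow> bool" where
  "positive_op a \<longleftrightarrow> a \<in> bounded_ops \<and> (\<forall>\<xi>. cinner (blinfun_apply a \<xi>) \<xi> \<in> \<real>\<^sub>\<ge>\<^sub>0)"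

text \<open>A real quadratic form agrees with that of the adjoint, so \<open>a - adj a\<close> has
  zero form. This depends on the scalars being complex.\<close>

lemma positive_op_selfadjoint:
  assumes "positive_op a"
  shows "adj a = a"
proof -
  have a: "a \<in> bounded_ops" using assms by (simp add: positive_op_def)
  have "a - adj a = 0"
  proof (rule quadratic_form_zero)
    fix \<xi>
    have "cinner \<xi> (blinfun_apply a \<xi>) = cinner (blinfun_apply a \<xi>) \<xi>"
      using assms nonneg_Reals_subset_Reals unfolding positive_op_def
      by (metis Reals_cnj_iff cinner_commute subsetD)
    thus "cinner (blinfun_apply (a - adj a) \<xi>) \<xi> = 0"
      by (simp add: blinfun_rep cinner_simps cinner_adj_left a)
  qed (intro bounded_ops_intros adj_bounded_ops a)
  thus ?thesis by simp
qed

lemma positive_opI: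
  assumes "a \<in> bounded_ops" "adj a = a" "\<And>\<xi>. Re (cinner (blinfun_apply a \<xi>) \<xi>) \<ge> 0"
  shows "positive_op a"
proof -
  have "Im (cinner (blinfun_apply a \<xi>) \<xi>) = 0" for \<xi>
    using selfadjoint_cinner[OF assms(1,2), of \<xi> \<xi>] cinner_commute[of "blinfun_apply a \<xi>" \<xi>]
    by (simp add: complex_eq_iff)
  thus ?thesis using assms by (simp add: positive_op_def complex_nonneg_Reals_iff)
qed

text \<open>With d = p - q, commutation gives (p + q) d = 0. At a vector \<eta> = d \<xi> the forms
  of p and q are nonnegative with sum zero, so both vanish, and hence so does the form of d. This
  says that d cubed has zero form; as d is self-adjoint, d and its square have the same kernel, and
  d = 0.\<close>

lemma positive_op_sqrt_unique:
  assumes p: "positive_op p" and q: "positive_op q"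
    and comm: "p o\<^sub>L q = q o\<^sub>L p" and sq: "p o\<^sub>L p = q o\<^sub>L q"
  shows "p = q"
proof -
  define d where "d = p - q"
  note P = p[unfolded positive_op_def] q[unfolded positive_op_def]
  have d: "d \<in> bounded_ops" "adj d = d"
    using P positive_op_selfadjoint[OF p] positive_op_selfadjoint[OF q]
    by (auto simp: d_def adj_minus)
  have pq: "blinfun_apply p (blinfun_apply q \<xi>) = blinfun_apply q (blinfun_apply p \<xi>)"
    "blinfun_apply p (blinfun_apply p \<xi>) = blinfun_apply q (blinfun_apply q \<xi>)" for \<xi>
    using comm sq by (metis blinfun_apply_blinfun_compose)+
  have zero: "cinner (blinfun_apply d \<eta>) \<eta> = 0" if "\<eta> = blinfun_apply d \<xi>" for \<xi> \<eta>
  proof -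
    have "blinfun_apply p \<eta> + blinfun_apply q \<eta> = 0"
      by (simp add: that d_def blinfun_rep blinfun.diff_right pq)
    hence "cinner (blinfun_apply p \<eta>) \<eta> + cinner (blinfun_apply q \<eta>) \<eta> = 0"
      by (metis cinner_simps(1,5))
    moreover have "cinner (blinfun_apply p \<eta>) \<eta> \<in> \<real>\<^sub>\<ge>\<^sub>0" "cinner (blinfun_apply q \<eta>) \<eta> \<in> \<real>\<^sub>\<ge>\<^sub>0"
      using P by auto
    ultimately have "cinner (blinfun_apply p \<eta>) \<eta> = 0" "cinner (blinfun_apply q \<eta>) \<eta> = 0"
      unfolding complex_nonneg_Reals_iff complex_eq_iff by auto
    thus ?thesis by (simp add: d_def blinfun_rep cinner_simps)
  qed
  note sd = selfadjoint_cinner[OF d]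
  have "d o\<^sub>L (d o\<^sub>L d) = 0"
    by (rule quadratic_form_zero) (use d zero[OF refl] in \<open>auto simp: sd\<close>)
  hence d3: "blinfun_apply d (blinfun_apply d (blinfun_apply d \<xi>)) = 0" for \<xi>
    by (metis blinfun_apply_blinfun_compose zero_blinfun.rep_eq)
  have null: "blinfun_apply d \<xi> = 0" if "blinfun_apply d (blinfun_apply d \<xi>) = 0" for \<xi>
  proof -
    have "cinner (blinfun_apply d \<xi>) (blinfun_apply d \<xi>) = 0"
      using that by (simp add: sd cinner_simps)
    thus ?thesis by (simp add: cinner_self)
  qed
  have "d = 0"
    by (rule blinfun_eqI) (simp add: null d3)
  thus ?thesis by (simp add: d_def)
qed

section \<open>Square roots and absolute values inside a C*-algebra\<close>

lemma norm_compose_diff_squares: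
  assumes "norm (y :: 'k op) \<le> s" "norm z \<le> r"
  shows "norm ((y o\<^sub>L y) - (z o\<^sub>L z)) \<le> (s + r) * norm (y - z)"
proof -
  \<comment> \<open>A splitting of the difference of squares that is valid without
    commutativity.\<close>
  have "(y o\<^sub>L y) - (z o\<^sub>L z) = (y o\<^sub>L (y - z)) + ((y - z) o\<^sub>L z)"
    by (rule blinfun_eqI) (simp add: blinfun_rep blinfun.diff_right)
  also have "norm \<dots> \<le> norm y * norm (y - z) + norm (y - z) * norm z"
    by (intro norm_triangle_mono norm_blinfun_compose)
  also have "\<dots> \<le> s * norm (y - z) + norm (y - z) * r"
    using assms by (intro add_mono mult_mono order_trans[OF norm_ge_zero assms(1)]) auto
  finally show ?thesis by (simp add: algebra_simps)
qed

lemma unital_cstar_algebraD: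
  assumes "unital_cstar_algebra A"
  shows "A \<subseteq> bounded_ops" "closed A" "scalar_op c \<in> A" "id_blinfun \<in> A" "0 \<in> A"
    "a \<in> A \<Longrightarrow> b \<in> A \<Longrightarrow> a + b \<in> A" "a \<in> A \<Longrightarrow> b \<in> A \<Longrightarrow> a - b \<in> A"
    "a \<in> A \<Longrightarrow> b \<in> A \<Longrightarrow> a o\<^sub>L b \<in> A" "a \<in> A \<Longrightarrow> r *\<^sub>R a \<in> A" "a \<in> A \<Longrightarrow> adj a \<in> A"
    "a \<in> A \<Longrightarrow> a \<in> bounded_ops"
proof -
  note A = assms[unfolded unital_cstar_algebra_def]
  show sc: "a \<in> A \<Longrightarrow> r *\<^sub>R a \<in> A" for a r
    using A by (metis scalar_op_of_real)
  show "a \<in> A \<Longrightarrow> b \<in> A \<Longrightarrow> a - b \<in> A"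
    using A sc[of b "-1"] by (metis scaleR_minus1_left diff_conv_add_uminus)
  show "id_blinfun \<in> A"
    using A by (metis scalar_op_1)
  thus "0 \<in> A"
    using sc[of id_blinfun 0] by simp
qed (use assms in \<open>auto simp: unital_cstar_algebra_def\<close>)

text \<open>
  The root is \<open>1 - y\<close>, where \<open>y = (x + y\<^sup>2) / 2\<close> is found by iteration from \<open>0\<close>; the
  increments are dominated by those of the scalar iteration with \<open>x = 1\<close>, which increases to \<open>1\<close>.
\<close>
lemma sqrt_one_minus_exists:
  assumes A: "unital_cstar_algebra A" and x: "x \<in> A" "adj x = x" "norm x \<le> 1"
  obtains p where "p \<in> A" "positive_op p" "p o\<^sub>L p = id_blinfun - x"
proof -
  note AD = unital_cstar_algebraD[OF A]
  define f where "f y = (1/2) *\<^sub>R (x + (y o\<^sub>L y))" for y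
  define Y where "Y n = (f ^^ n) 0" for n
  define q where "q n = ((\<lambda>t::real. (1 + t\<^sup>2) / 2) ^^ n) 0" for n
  have Y0: "Y 0 = 0" and YS: "Y (Suc n) = f (Y n)" for n by (auto simp: Y_def)
  have q0: "q 0 = 0" and qS: "q (Suc n) = (1 + (q n)\<^sup>2) / 2" for n by (auto simp: q_def)
  have q1: "0 \<le> q n" "q n \<le> 1" for n
  proof (induction n)
    case (Suc n) case 2 show ?case
      using Suc power_mono[of "q n" 1 2] by (simp add: qS)
  qed (auto simp: q0 qS)
  have YA: "Y n \<in> A \<and> adj (Y n) = Y n" for n
  proof (induction n)
    case (Suc n)
    thus ?case
      using x AD by (simp add: YS f_def adj_scaleR adj_plus adj_compose)
  qed (simp add: Y0 adj_0 AD)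
  have Yq: "norm (Y n) \<le> q n" for n
  proof (induction n)
    case (Suc n)
    have "norm (x + (Y n o\<^sub>L Y n)) \<le> 1 + q n * q n"
      using Suc by (intro norm_triangle_mono x order_trans[OF norm_blinfun_compose] mult_mono)
          (auto simp: q1)
    thus ?case by (simp add: YS f_def qS power2_eq_square)
  qed (simp add: Y0 q0)
  have Yd: "norm (Y (Suc n) - Y n) \<le> q (Suc n) - q n" for n
  proof (induction n)
    case 0 show ?case using Yq[of "Suc 0"] by (simp add: Y0 q0)
  next
    case (Suc n)
    have "Y (Suc (Suc n)) - Y (Suc n) = (1/2) *\<^sub>R ((Y (Suc n) o\<^sub>L Y (Suc n)) - (Y n o\<^sub>L Y n))"
      unfolding YS[of "Suc n"] YS[of n] f_def[of "Y n"] f_def[of "Y (Suc n)", unfolded YS f_def]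
      by (simp add: YS f_def algebra_simps)
    hence "norm (Y (Suc (Suc n)) - Y (Suc n)) =
        norm ((Y (Suc n) o\<^sub>L Y (Suc n)) - (Y n o\<^sub>L Y n)) / 2"
      by simp
    also have "\<dots> \<le> (q (Suc n) + q n) * norm (Y (Suc n) - Y n) / 2"
      using norm_compose_diff_squares[OF Yq Yq, of "Suc n" n] by simp
    also have "\<dots> \<le> (q (Suc n) + q n) * (q (Suc n) - q n) / 2"
      by (intro divide_right_mono mult_left_mono Suc) (auto intro: add_nonneg_nonneg q1)
    also have "\<dots> = q (Suc (Suc n)) - q (Suc n)"
      by (simp add: qS[of "Suc n"] qS[of n] field_simps power2_eq_square)
    finally show ?case .
  qed
  \<comment> \<open>Monotonicity of the scalar iteration is read off from \<open>Yd\<close>, whose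
    left-hand side is a norm.\<close>
  have "incseq q"
  proof (rule incseq_SucI)
    show "q n \<le> q (Suc n)" for n
      using Yd[of n] norm_ge_zero[of "Y (Suc n) - Y n"] by linarith
  qed
  then obtain l where "q \<longlonglongrightarrow> l"
    using incseq_convergent[of q 1] q1(2) by metis
  hence "summable (\<lambda>n. q (Suc n) - q n)"
    by (rule telescope_summable)
  hence "summable (\<lambda>n. Y (Suc n) - Y n)"
    by (rule summable_comparison_test[rotated]) (use Yd in blast)
  hence "(\<lambda>n. \<Sum>i<n. Y (Suc i) - Y i) \<longlonglongrightarrow> (\<Sum>i. Y (Suc i) - Y i)"
    by (rule summable_LIMSEQ)
  then obtain y where y: "Y \<longlonglongrightarrow> y"
    unfolding sum_lessThan_telescope Y0 by auto
  have yA: "y \<in> A"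
    by (rule closed_sequentially[OF AD(2) _ y]) (use YA in blast)
  have adjy: "adj y = y"
  proof (rule LIMSEQ_unique)
    show "Y \<longlonglongrightarrow> adj y"
      using tendsto_adj[OF y] YA AD(11) yA by simp
  qed (rule y)
  have yn: "norm y \<le> 1"
    by (rule LIMSEQ_le_const2[OF tendsto_norm[OF y]]) (use Yq q1 order_trans in blast)
  have "(\<lambda>n. f (Y n)) \<longlonglongrightarrow> f y"
    unfolding f_def by (intro tendsto_intros bounded_bilinear.tendsto[OF
        bounded_bilinear_blinfun_compose] y)
  moreover have "(\<lambda>n. f (Y n)) \<longlonglongrightarrow> y"
    using LIMSEQ_Suc[OF y] by (simp add: YS)
  ultimately have fy: "f y = y" using LIMSEQ_unique by blast
  show thesis
  proof (rule that)
    show "id_blinfun - y \<in> A" by (intro AD yA)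
    show "positive_op (id_blinfun - y)"
    proof (rule positive_opI)
      show "id_blinfun - y \<in> bounded_ops" using \<open>id_blinfun - y \<in> A\<close> by (rule AD)
      show "adj (id_blinfun - y) = id_blinfun - y"
        using AD yA adjy by (simp add: adj_minus adj_id)
      fix \<xi>
      have "Re (cinner (blinfun_apply y \<xi>) \<xi>) \<le> norm (blinfun_apply y \<xi>) * norm \<xi>"
        using cmod_cinner_le complex_Re_le_cmod order_trans by blast
      also have "\<dots> \<le> norm y * norm \<xi> * norm \<xi>"
        by (intro mult_right_mono norm_blinfun) auto
      also have "\<dots> \<le> 1 * norm \<xi> * norm \<xi>"
        by (intro mult_right_mono yn) auto
      finally show "Re (cinner (blinfun_apply (id_blinfun - y) \<xi>) \<xi>) \<ge> 0"
        by (simp add: blinfun_rep cinner_simps cinner_self power2_eq_square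
            del: of_real_mult of_real_power)
    qed
    \<comment> \<open>The fixed point equation says 2 y = x + y y, which turns 1 - 2 y + y y into 1
      - x.\<close>
    have "(id_blinfun - y) o\<^sub>L (id_blinfun - y) = id_blinfun - 2 *\<^sub>R y + (y o\<^sub>L y)"
      by (rule blinfun_eqI) (simp add: blinfun_rep blinfun.diff_right scaleR_2)
    also have "2 *\<^sub>R y = x + (y o\<^sub>L y)"
      using arg_cong[OF fy, of "(*\<^sub>R) 2"] by (simp add: f_def)
    finally show "(id_blinfun - y) o\<^sub>L (id_blinfun - y) = id_blinfun - x" by simp
  qed
qed

text \<open>Expanding the square of the norm of \<xi> - c c \<xi> leaves the terms - 2 |c \<xi>|^2 +
  |c c \<xi>|^2 beside |\<xi>|^2, and their sum is at most zero because c is a contraction.\<close>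

lemma norm_one_minus_square_le:
  assumes c: "c \<in> bounded_ops" "adj c = c" "norm c \<le> 1"
  shows "norm (id_blinfun - (c o\<^sub>L c)) \<le> 1"
proof (rule norm_blinfun_bound)
  fix \<xi>
  have le: "norm (blinfun_apply c \<eta>) \<le> norm \<eta>" for \<eta>
    using norm_blinfun[of c \<eta>] mult_right_mono[OF c(3), of "norm \<eta>"] by simp
  have "cinner (\<xi> - blinfun_apply c (blinfun_apply c \<xi>)) (\<xi> - blinfun_apply c (blinfun_apply c \<xi>)) =
      cinner \<xi> \<xi> - 2 * cinner (blinfun_apply c \<xi>) (blinfun_apply c \<xi>) +
      cinner (blinfun_apply c (blinfun_apply c \<xi>)) (blinfun_apply c (blinfun_apply c \<xi>))"
    by (simp add: cinner_simps selfadjoint_cinner[OF c(1,2)])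
  from arg_cong[OF this, of Re]
  have "(norm (\<xi> - blinfun_apply c (blinfun_apply c \<xi>)))\<^sup>2 =
      (norm \<xi>)\<^sup>2 - 2 * (norm (blinfun_apply c \<xi>))\<^sup>2
      + (norm (blinfun_apply c (blinfun_apply c \<xi>)))\<^sup>2"
    by (simp add: cinner_self del: of_real_power)
  also have "\<dots> \<le> (norm \<xi>)\<^sup>2"
    using power_mono[OF le[of "blinfun_apply c \<xi>"] norm_ge_zero, of 2] zero_le_power2[of
        "norm (blinfun_apply c \<xi>)"] by linarith
  finally have "norm (\<xi> - blinfun_apply c (blinfun_apply c \<xi>)) \<le> norm \<xi>"
    by (rule power2_le_imp_le) simp
  thus "norm (blinfun_apply (id_blinfun - (c o\<^sub>L c)) \<xi>) \<le> 1 * norm \<xi>"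
    by (simp add: blinfun_rep)
qed simp

text \<open>After rescaling \<open>c\<close> to a contraction, its square is 1 - x with x a
  self-adjoint contraction, to which the square root construction applies.\<close>

lemma absolute_value_exists:
  assumes A: "unital_cstar_algebra A" and c: "c \<in> A" "adj c = c"
  obtains p where "p \<in> A" "positive_op p" "p o\<^sub>L p = c o\<^sub>L c"
proof -
  note AD = unital_cstar_algebraD[OF A]
  \<comment> \<open>The summand 1 keeps \<open>r\<close> positive when \<open>c\<close> is
    zero.\<close>
  define r where "r = norm c + 1"
  define c' where "c' = (1/r) *\<^sub>R c"
  have r: "r > 0" using norm_ge_zero[of c] unfolding r_def by linarith
  have c': "c' \<in> A" "adj c' = c'" "norm c' \<le> 1"
    using c AD r by (auto simp: c'_def adj_scaleR) (simp add: r_def)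
  define x where "x = id_blinfun - (c' o\<^sub>L c')"
  have x: "x \<in> A" "adj x = x" "norm x \<le> 1"
    using c' AD
    by (auto simp: x_def norm_one_minus_square_le adj_minus adj_compose adj_id)
  obtain p where p: "p \<in> A" "positive_op p" "p o\<^sub>L p = id_blinfun - x"
    using sqrt_one_minus_exists[OF A x] .
  show thesis
  proof (rule that)
    show "r *\<^sub>R p \<in> A" by (intro AD p)
    show "positive_op (r *\<^sub>R p)"
      using p(2) r by (auto simp: positive_op_def blinfun_rep cinner_simps
          complex_nonneg_Reals_iff bounded_ops_intros)
    have "(r *\<^sub>R p) o\<^sub>L (r *\<^sub>R p) = (r * r) *\<^sub>R (p o\<^sub>L p)"
      by (rule blinfun_eqI) (simp add: blinfun_rep blinfun.scaleR_right)
    also have "p o\<^sub>L p = (1 / (r * r)) *\<^sub>R (c o\<^sub>L c)"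
      unfolding p(3) x_def c'_def by (rule blinfun_eqI) (simp add: blinfun_rep blinfun.scaleR_right)
    finally show "(r *\<^sub>R p) o\<^sub>L (r *\<^sub>R p) = c o\<^sub>L c" using r by simp
  qed
qed

text \<open>Let p be the absolute value of c. The images of p and c are positive, commute because B
  is abelian, and have the same square, so they coincide; injectivity gives c = p.\<close>

lemma injective_hom_reflects_positive:
  assumes A: "unital_cstar_algebra A" and hom: "unital_star_hom A B \<phi>" and inj: "inj_on \<phi> A"
    and B: "abelian_ops B" and pos: "\<And>a. a \<in> A \<Longrightarrow> positive_op a \<Longrightarrow> positive_op (\<phi> a)"
    and c: "c \<in> A" "adj c = c" "positive_op (\<phi> c)"
  shows "positive_op c"
proof -
  obtain p where p: "p \<in> A" "positive_op p" "p o\<^sub>L p = c o\<^sub>L c"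
    using absolute_value_exists[OF A c(1,2)] .
  note H = hom[unfolded unital_star_hom_def]
  have "\<phi> p = \<phi> c"
  proof (rule positive_op_sqrt_unique)
    show "\<phi> p o\<^sub>L \<phi> c = \<phi> c o\<^sub>L \<phi> p"
      using B H p(1) c(1) unfolding abelian_ops_def by blast
    show "\<phi> p o\<^sub>L \<phi> p = \<phi> c o\<^sub>L \<phi> c"
      using H p(1,3) c(1) by metis
  qed (use pos p c in auto)
  hence "p = c" using inj p(1) c(1) by (auto dest: inj_onD)
  thus ?thesis using p by simp
qed

section \<open>Completely positive maps\<close>

text \<open>The case of 1 by 1 matrices.\<close>

lemma ucp_positive:
  assumes "ucp S T E" "T \<subseteq> bounded_ops" "a \<in> S" "positive_op a"
  shows "positive_op (E a)"
proof -
  have "matrix_positive 1 (\<lambda>_ _. a)"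
    using assms(4) by (simp add: matrix_positive_def positive_op_def)
  hence "matrix_positive 1 (\<lambda>_ _. E a)"
    using assms(1,3) by (simp add: ucp_def)
  hence "cinner (blinfun_apply (E a) \<xi>) \<xi> \<in> \<real>\<^sub>\<ge>\<^sub>0" for \<xi>
    unfolding matrix_positive_def by (drule_tac x = "\<lambda>_. \<xi>" in spec) simp
  thus ?thesis using assms by (auto simp: positive_op_def ucp_def)
qed

text \<open>The associated form is the squared norm of the single vector \<zeta>.\<close>

lemma matrix_positive_gram:
  assumes "\<And>i. v i \<in> bounded_ops"
  shows "matrix_positive n (\<lambda>i j. adj (v i) o\<^sub>L v j)"
  unfolding matrix_positive_def
proof
  fix \<xi> :: "nat \<Rightarrow> 'a ell2"
  define \<zeta> where "\<zeta> = (\<Sum>j<n. blinfun_apply (v j) (\<xi> j))"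
  have sum_left: "cinner (\<Sum>j<n. f j) \<eta> = (\<Sum>j<n. cinner (f j) \<eta>)" for f :: "nat \<Rightarrow> 'a ell2" and \<eta>
    by (rule linear_sum[OF bounded_linear.linear[OF bounded_linear_cinner_left]])
  have sum_right: "cinner \<eta> (\<Sum>j<n. f j) = (\<Sum>j<n. cinner \<eta> (f j))" for f :: "nat \<Rightarrow> 'a ell2" and \<eta>
    unfolding cinner_commute[of \<eta>] sum_left by simp
  have "(\<Sum>i<n. \<Sum>j<n. cinner (blinfun_apply (adj (v i) o\<^sub>L v j) (\<xi> j)) (\<xi> i)) = cinner \<zeta> \<zeta>"
    by (simp add: cinner_adj_left assms \<zeta>_def sum_right) (simp add: sum_left)
  thus "(\<Sum>i<n. \<Sum>j<n. cinner (blinfun_apply (adj (v i) o\<^sub>L v j) (\<xi> j)) (\<xi> i)) \<in> \<real>\<^sub>\<ge>\<^sub>0"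
    by (simp add: cinner_self complex_nonneg_Reals_iff del: of_real_power)
qed

text \<open>
  Choi's argument: the Gram matrix of \<open>1, h, w\<close> is positive, and its image under \<open>E\<close> vanishes on
  the vectors \<open>(- E(h) \<xi>, \<xi>, 0)\<close>, which are therefore in the kernel of the form.
\<close>
lemma ucp_multiplicative_domain:
  assumes C: "unital_cstar_algebra C" and E: "ucp C T E" and T: "T \<subseteq> bounded_ops"
    and h: "h \<in> C" "adj h = h" "adj (E h) = E h" "E (h o\<^sub>L h) = E h o\<^sub>L E h" and w: "w \<in> C"
  shows "E (h o\<^sub>L w) = E h o\<^sub>L E w" "E (adj w o\<^sub>L h) = E (adj w) o\<^sub>L E h"
proof -
  note CD = unital_cstar_algebraD[OF C]
  have ET: "E a \<in> bounded_ops" if "a \<in> C" for a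
    using that E T by (auto simp: ucp_def)
  define v where "v i = (if i = 0 then id_blinfun else if i = Suc 0 then h else w)" for i :: nat
  have v: "v i \<in> C" for i using CD h w by (simp add: v_def)
  have "matrix_positive 3 (\<lambda>i j. adj (v i) o\<^sub>L v j)"
    by (rule matrix_positive_gram) (intro CD v)
  hence mp: "matrix_positive 3 (\<lambda>i j. E (adj (v i) o\<^sub>L v j))"
    using E CD v by (simp add: ucp_def)
  define X where "X = E (h o\<^sub>L w) - (E h o\<^sub>L E w)"
  define Y where "Y = E (adj w o\<^sub>L h) - (E (adj w) o\<^sub>L E h)"
  define W where "W = E (adj w o\<^sub>L w)"
  have XY: "X \<in> bounded_ops" "Y \<in> bounded_ops"
    unfolding X_def Y_def by (intro bounded_ops_intros ET CD h w)+
  have id: "E id_blinfun = id_blinfun"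
    using E by (simp add: ucp_def scalar_op_1)
  have comp: "adj w o\<^sub>L id_blinfun = adj w" "id_blinfun o\<^sub>L a = a" "a o\<^sub>L id_blinfun = a"
      for a :: "'a op"
    by (auto intro!: blinfun_eqI)
  have form: "cinner (blinfun_apply X \<eta>) \<xi> + cinner (blinfun_apply Y \<xi>) \<eta> +
      cinner (blinfun_apply W \<eta>) \<eta> \<in> \<real>\<^sub>\<ge>\<^sub>0" for \<xi> \<eta>
  proof -
    \<comment> \<open>The first two entries are chosen so that the four terms from 1 and h cancel,
      by E(h h) = E(h) E(h). What remains is affine in \<xi>, with constant term given by
      \<open>W\<close>.\<close>
    define \<zeta> where "\<zeta> i = (if i = 0 then - blinfun_apply (E h) \<xi> else
      if i = Suc 0 then \<xi> else \<eta>)" for i :: nat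
    have "(\<Sum>i<3. \<Sum>j<3. cinner (blinfun_apply (E (adj (v i) o\<^sub>L v j)) (\<zeta> j)) (\<zeta> i)) \<in> \<real>\<^sub>\<ge>\<^sub>0"
      using mp unfolding matrix_positive_def by blast
    thus ?thesis
      by (simp add: numeral_3_eq_3 v_def \<zeta>_def id adj_id h comp blinfun_rep blinfun.minus_right
          cinner_simps
          selfadjoint_cinner[OF ET[OF h(1)] h(3)] X_def Y_def W_def add_ac)
  qed
  have W: "Im (cinner (blinfun_apply W \<eta>) \<eta>) = 0" for \<eta>
    using form[of \<eta> 0] by (simp add: cinner_simps complex_nonneg_Reals_iff)
  have re: "Re (cinner (blinfun_apply X \<eta>) \<xi> + cinner (blinfun_apply Y \<xi>) \<eta>) = 0" for \<xi> \<eta>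
  proof (rule ccontr)
    let ?r = "Re (cinner (blinfun_apply X \<eta>) \<xi> + cinner (blinfun_apply Y \<xi>) \<eta>)"
      and ?k = "Re (cinner (blinfun_apply W \<eta>) \<eta>)"
    assume "?r \<noteq> 0"
    \<comment> \<open>Scaling \<xi> by this \<open>t\<close> would bring the form down to
      -1.\<close>
    define t where "t = - (?k + 1) / ?r"
    have "0 \<le> t * ?r + ?k"
      using form[of \<eta> "t *\<^sub>R \<xi>"]
      by (simp add: cinner_simps complex_nonneg_Reals_iff blinfun.scaleR_right algebra_simps)
    thus False using \<open>?r \<noteq> 0\<close> by (simp add: t_def)
  qed
  \<comment> \<open>The form is real, so the two imaginary parts have sum zero; \<open>re\<close> at
    i \<xi> says that they are equal.\<close>
  have im: "Im (cinner (blinfun_apply X \<eta>) \<xi>) = 0 \<and> Im (cinner (blinfun_apply Y \<xi>) \<eta>) = 0" for \<xi> \<eta>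
    using form[of \<eta> \<xi>] W[of \<eta>] re[of \<eta> "cscale \<i> \<xi>"]
    by (auto simp: complex_nonneg_Reals_iff cinner_simps bounded_opsD[OF XY(2)])
  have "X = 0"
  proof (rule blinfun_eqI, rule cinner_eqI)
    show "cinner (blinfun_apply X \<eta>) \<xi> = cinner (blinfun_apply 0 \<eta>) \<xi>" for \<xi> \<eta>
      using im[of \<eta> \<xi>] im[of \<eta> "cscale \<i> \<xi>"] by (simp add: cinner_simps complex_eq_iff)
  qed
  thus "E (h o\<^sub>L w) = E h o\<^sub>L E w" by (simp add: X_def)
  have "Y = 0"
  proof (rule blinfun_eqI, rule cinner_eqI)
    show "cinner (blinfun_apply Y \<xi>) \<eta> = cinner (blinfun_apply 0 \<xi>) \<eta>" for \<xi> \<eta>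
      using im[of \<eta> \<xi>] im[of "cscale \<i> \<eta>" \<xi>] by (simp add: cinner_simps complex_eq_iff)
  qed
  thus "E (adj w o\<^sub>L h) = E (adj w) o\<^sub>L E h" by (simp add: Y_def)
qed

section \<open>The reduced crossed product\<close>

lemma blinfun_compose_assoc: "(a o\<^sub>L b) o\<^sub>L c = a o\<^sub>L (b o\<^sub>L c)"
  by (rule blinfun_eqI) simp

text \<open>The commutant is cut out of \<open>C\<close> by equations between continuous maps, hence
  closed. It contains adjoints because \<open>D\<close> does: take adjoints in the relation of
  \<open>a\<close> with \<open>adj d\<close>.\<close>

lemma unital_cstar_relative_commutant:
  assumes C: "unital_cstar_algebra C" and D: "D \<subseteq> bounded_ops" "\<And>d. d \<in> D \<Longrightarrow> adj d \<in> D"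
  shows "unital_cstar_algebra (relative_commutant C D)"
proof -
  note CD = unital_cstar_algebraD[OF C]
  have "closed (C \<inter> (\<Inter>d\<in>D. {a. a o\<^sub>L d = d o\<^sub>L a}))"
  proof (intro closed_Int CD(2) closed_INT ballI closed_Collect_eq)
    show "continuous_on UNIV (\<lambda>a. a o\<^sub>L d)" "continuous_on UNIV (\<lambda>a. d o\<^sub>L a)" for d :: "'a op"
      using bounded_bilinear.bounded_linear_left[OF bounded_bilinear_blinfun_compose]
        bounded_bilinear.bounded_linear_right[OF bounded_bilinear_blinfun_compose]
      by (blast intro: linear_continuous_on)+
  qed
  also have "C \<inter> (\<Inter>d\<in>D. {a. a o\<^sub>L d = d o\<^sub>L a}) = relative_commutant C D"
    by (auto simp: relative_commutant_def)
  finally have "closed (relative_commutant C D)" .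
  moreover have "adj a o\<^sub>L d = d o\<^sub>L adj a" if "a \<in> C" "\<forall>d\<in>D. a o\<^sub>L d = d o\<^sub>L a" "d \<in> D" for a d
  proof -
    have bdd: "a \<in> bounded_ops" "d \<in> bounded_ops" using that D CD by auto
    have "adj a o\<^sub>L d = adj (adj d o\<^sub>L a)"
      by (simp add: adj_compose adj_adj adj_bounded_ops bdd)
    also have "adj d o\<^sub>L a = a o\<^sub>L adj d" using that D by simp
    also have "adj (a o\<^sub>L adj d) = d o\<^sub>L adj a"
      by (simp add: adj_compose adj_adj adj_bounded_ops bdd)
    finally show ?thesis .
  qed
  moreover have "scalar_op c o\<^sub>L d = d o\<^sub>L scalar_op c" if "d \<in> D" for c d
    using that D by (intro blinfun_eqI) (auto simp: bounded_opsD subset_iff)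
  moreover have "(a + b) o\<^sub>L d = d o\<^sub>L (a + b)" "(a o\<^sub>L b) o\<^sub>L d = d o\<^sub>L (a o\<^sub>L b)"
    if "a o\<^sub>L d = d o\<^sub>L a" "b o\<^sub>L d = d o\<^sub>L b" for a b d :: "'a op"
  proof -
    show "(a + b) o\<^sub>L d = d o\<^sub>L (a + b)"
      using that by (simp add: bounded_bilinear.add_left[OF bounded_bilinear_blinfun_compose]
          bounded_bilinear.add_right[OF bounded_bilinear_blinfun_compose])
    show "(a o\<^sub>L b) o\<^sub>L d = d o\<^sub>L (a o\<^sub>L b)"
      using that by (metis blinfun_compose_assoc)
  qed
  ultimately show ?thesis
    using CD unfolding unital_cstar_algebra_def by (auto simp: relative_commutant_def)
qed

text \<open>The span of a multiplicative self-adjoint set is a *-algebra, and continuity of the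
  operations extends this to the closure. The span is real; complex scalars enter through the
  operators \<open>scalar_op c\<close> in \<open>G\<close>.\<close>

lemma unital_cstar_closure_span:
  assumes bdd: "G \<subseteq> bounded_ops" and sc: "\<And>c. scalar_op c \<in> G"
    and comp: "\<And>a b. a \<in> G \<Longrightarrow> b \<in> G \<Longrightarrow> (a o\<^sub>L b) \<in> G" and adj: "\<And>a. a \<in> G \<Longrightarrow> adj a \<in> G"
  shows "unital_cstar_algebra (closure (span G))" "\<And>a. a \<in> span G \<Longrightarrow> adj a \<in> span G"
    "\<And>a b. a \<in> span G \<Longrightarrow> b \<in> span G \<Longrightarrow> (a o\<^sub>L b) \<in> span G"
proof -
  note bil = bounded_bilinear_blinfun_compose
  have "subspace bounded_ops"
    unfolding subspace_def by auto
  hence sb: "span G \<subseteq> bounded_ops" using bdd by (rule span_minimal[rotated])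
  hence cb: "closure (span G) \<subseteq> bounded_ops" using closed_bounded_ops by (rule closure_minimal)
  have comp1: "(a o\<^sub>L b) \<in> span G" if "a \<in> span G" "b \<in> G" for a b
    using that(1)
  proof (induction rule: span_induct_alt)
    case (step c x y)
    thus ?case using comp[OF _ that(2)]
      by (simp add: bounded_bilinear.add_left[OF bil] bounded_bilinear.scaleR_left[OF bil]
          span_add span_scale span_base)
  qed (simp add: bounded_bilinear.zero_left[OF bil] span_zero)
  show comp2: "(a o\<^sub>L b) \<in> span G" if "a \<in> span G" "b \<in> span G" for a b
    using that(2)
  proof (induction rule: span_induct_alt)
    case (step c x y)
    thus ?case using comp1[OF that(1)]
      by (simp add: bounded_bilinear.add_right[OF bil] bounded_bilinear.scaleR_right[OF bil]
          span_add span_scale)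
  qed (simp add: bounded_bilinear.zero_right[OF bil] span_zero)
  \<comment> \<open>Membership of \<open>a\<close> is carried through the induction because
    \<open>adj_plus\<close> asks for bounded complex-linear summands.\<close>
  have "a \<in> span G \<and> adj a \<in> span G" if "a \<in> span G" for a
    using that
  proof (induction rule: span_induct_alt)
    case (step c x y)
    hence "adj (c *\<^sub>R x + y) = c *\<^sub>R adj x + adj y"
      using bdd sb by (subst adj_plus) (auto simp: adj_scaleR bounded_ops_intros subset_iff dest:
          span_base)
    thus ?case using step adj by (simp add: span_add span_scale span_base)
  qed (simp add: adj_0 span_zero)
  thus adj2: "adj a \<in> span G" if "a \<in> span G" for a
    using that by blast
  have cl: "(\<And>n. X n \<in> span G) \<Longrightarrow> X \<longlonglongrightarrow> a \<Longrightarrow> a \<in> closure (span G)" for X a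
    unfolding closure_sequential by blast
  have "a + b \<in> closure (span G) \<and> (a o\<^sub>L b) \<in> closure (span G)"
    if a: "a \<in> closure (span G)" and b: "b \<in> closure (span G)" for a b
  proof -
    obtain X Y where X: "\<And>n. X n \<in> span G" "X \<longlonglongrightarrow> a" and Y: "\<And>n. Y n \<in> span G" "Y \<longlonglongrightarrow> b"
      using a b unfolding closure_sequential by blast
    have "(\<lambda>n. X n + Y n) \<longlonglongrightarrow> a + b" "(\<lambda>n. X n o\<^sub>L Y n) \<longlonglongrightarrow> (a o\<^sub>L b)"
      using X Y by (intro tendsto_add bounded_bilinear.tendsto[OF bil]; simp)+
    thus ?thesis using cl X Y comp2 span_add by (metis (no_types, lifting))
  qed
  moreover have "adj a \<in> closure (span G)" if a: "a \<in> closure (span G)" for a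
  proof -
    obtain X where X: "\<And>n. X n \<in> span G" "X \<longlonglongrightarrow> a"
      using a unfolding closure_sequential by blast
    have "(\<lambda>n. adj (X n)) \<longlonglongrightarrow> adj a"
      using X sb cb a by (intro tendsto_adj) auto
    thus ?thesis using cl X adj2 by (metis (no_types, lifting))
  qed
  moreover have "scalar_op c \<in> closure (span G)" for c
    using sc closure_subset span_base by blast
  ultimately show "unital_cstar_algebra (closure (span G))"
    unfolding unital_cstar_algebra_def using cb by simp
qed

lemma norm_ell2_mono:
  assumes "\<And>k. cmod (coord \<xi> k) \<le> B * cmod (coord \<eta> k)" "B \<ge> 0"
  shows "norm \<xi> \<le> B * norm \<eta>"
proof (rule power2_le_imp_le)
  have "(norm \<xi>)\<^sup>2 \<le> (\<Sum>\<^sub>\<infinity>k. B\<^sup>2 * (cmod (coord \<eta> k))\<^sup>2)"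
    unfolding norm_ell2_sq
    by (intro infsum_mono coord_sq_summable summable_on_cmult_right)
      (use power_mono[OF assms(1) norm_ge_zero, where n = 2] in \<open>simp add: power_mult_distrib\<close>)
  thus "(norm \<xi>)\<^sup>2 \<le> (B * norm \<eta>)\<^sup>2"
    by (simp add: infsum_cmult_right' norm_ell2_sq[symmetric] power_mult_distrib)
qed (use assms in simp)

section \<open>Generators of the crossed product and the covariance relation\<close>

definition crossed_monomials :: "('g::group_add \<Rightarrow> 'x::topological_space \<Rightarrow> 'x) \<Rightarrow> ('g \<times> 'x) op set"
    where
  "crossed_monomials act = {mult_op act f o\<^sub>L translation_op t | f t. continuous_on UNIV f}"

lemma crossed_monomialsE:
  assumes "a \<in> crossed_monomials act"
  obtains f t where "continuous_on UNIV f" "a = (mult_op act f o\<^sub>L translation_op t)"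
  using assms by (auto simp: crossed_monomials_def)

lemma translation_op_bounded: "translation_op t \<in> bounded_ops"
  by (auto intro!: ell2_eqI simp: bounded_ops_def coord_translation_op)

lemma translation_op_0: "translation_op 0 = id_blinfun"
  by (auto intro!: ell2_eqI blinfun_eqI simp: coord_translation_op)

lemma translation_op_compose: "translation_op s o\<^sub>L translation_op t = translation_op (s + t)"
  by (auto intro!: ell2_eqI blinfun_eqI simp: coord_translation_op minus_add add.assoc
      diff_conv_add_uminus simp del: add_uminus_conv_diff)

lemma adj_translation_op: "adj (translation_op t :: ('g::group_add \<times> 'x) op) = translation_op (- t)"
proof (rule adj_eqI)
  fix \<xi> \<eta> :: "('g \<times> 'x) ell2"
  define h where "h = (\<lambda>(s, x :: 'x). (- t + s, x))"
  have "bij_betw h UNIV UNIV"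
    by (rule bij_betw_byWitness[where f' = "\<lambda>(s, x). (t + s, x)"])
      (auto simp: h_def simp flip: add.assoc)
  hence "(\<Sum>\<^sub>\<infinity>k. coord \<xi> (h k) * cnj (coord (blinfun_apply (translation_op (- t)) \<eta>) (h k))) =
      (\<Sum>\<^sub>\<infinity>k. coord \<xi> k * cnj (coord (blinfun_apply (translation_op (- t)) \<eta>) k))"
    by (rule infsum_reindex_bij_betw)
  moreover have "coord \<xi> (h k) * cnj (coord (blinfun_apply (translation_op (- t)) \<eta>) (h k)) =
      coord (blinfun_apply (translation_op t) \<xi>) k * cnj (coord \<eta> k)" for k
    by (cases k) (simp add: h_def coord_translation_op flip: add.assoc)
  ultimately show "cinner (blinfun_apply (translation_op t) \<xi>) \<eta> =
      cinner \<xi> (blinfun_apply (translation_op (- t)) \<eta>)"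
    by (simp add: cinner_def)
qed

context
  fixes act :: "'g::group_add \<Rightarrow> 'x::t2_space \<Rightarrow> 'x"
  assumes compact: "compact (UNIV :: 'x set)" and action: "continuous_action act"
begin

lemma act_simps: "act 0 x = x" "act (s + t) x = act s (act t x)"
  "act (- s) (act s x) = x" "act s (act (- s) x) = x"
  using action unfolding continuous_action_def by (auto, (metis left_minus right_minus)+)

lemma continuous_act: "continuous_on A (act s)"
  using action unfolding continuous_action_def homeomorphism_def
  by (meson continuous_on_subset subset_UNIV)

lemma continuous_comp_act: "continuous_on UNIV f \<Longrightarrow> continuous_on UNIV (\<lambda>x. f (act s x))"
  by (rule continuous_on_compose2[OF _ continuous_act]) auto

lemmas coord_mult = coord_mult_op[OF compact]

lemma mult_op_bounded: "continuous_on UNIV f \<Longrightarrow> mult_op act f \<in> bounded_ops"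
  by (auto intro!: ell2_eqI simp: bounded_ops_def coord_mult)

lemma mult_op_compose:
  assumes "continuous_on UNIV f" "continuous_on UNIV g"
  shows "mult_op act f o\<^sub>L mult_op act g = mult_op act (\<lambda>x. f x * g x)"
  using assms by (auto intro!: ell2_eqI blinfun_eqI simp: coord_mult continuous_on_mult)

lemma adj_mult_op:
  assumes "continuous_on UNIV f"
  shows "adj (mult_op act f) = mult_op act (\<lambda>x. cnj (f x))"
proof (rule adj_eqI)
  show "cinner (blinfun_apply (mult_op act f) \<xi>) \<eta> =
      cinner \<xi> (blinfun_apply (mult_op act (\<lambda>x. cnj (f x))) \<eta>)" for \<xi> \<eta>
    unfolding cinner_def
    by (rule infsum_cong) (use assms in \<open>auto simp: coord_mult continuous_on_cnj mult_ac\<close>)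
qed

lemma mult_op_const: "mult_op act (\<lambda>_. c) = scalar_op c"
  by (auto intro!: ell2_eqI blinfun_eqI simp: coord_mult)

lemma norm_mult_op_le:
  assumes "continuous_on UNIV f" "\<And>x. cmod (f x) \<le> B" "B \<ge> 0"
  shows "norm (mult_op act f) \<le> B"
proof (rule norm_blinfun_bound)
  show "norm (blinfun_apply (mult_op act f) \<xi>) \<le> B * norm \<xi>" for \<xi>
    by (rule norm_ell2_mono)
      (use assms in \<open>auto simp: coord_mult norm_mult intro!: mult_right_mono\<close>)
qed (fact assms(3))

lemma mult_op_ket:
  "continuous_on UNIV f \<Longrightarrow> blinfun_apply (mult_op act f) (ket (s, x)) =
      cscale (f (act s x)) (ket (s, x))"
  by (auto intro!: ell2_eqI simp: coord_mult)

text \<open>The covariance relation: moving \<open>translation_op t\<close> past f replaces f by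
  \<alpha>_t(f). It brings every product of generators back to the form of a monomial.\<close>

lemma translation_mult_op:
  assumes "continuous_on UNIV f"
  shows "translation_op t o\<^sub>L mult_op act f =
      mult_op act (\<lambda>x. f (act (- t) x)) o\<^sub>L translation_op t"
  using assms continuous_comp_act[OF assms]
  by (auto intro!: ell2_eqI blinfun_eqI simp: coord_mult coord_translation_op act_simps)

lemma crossed_monomials_bounded: "crossed_monomials act \<subseteq> bounded_ops"
  by (auto elim!: crossed_monomialsE intro: mult_op_bounded translation_op_bounded)

lemma mult_op_monomial: "continuous_on UNIV f \<Longrightarrow> mult_op act f \<in> crossed_monomials act"
  unfolding crossed_monomials_def
  by (auto simp: translation_op_0 intro!: exI[of _ f] exI[of _ 0] blinfun_eqI)

lemma monomial_compose:
  assumes "continuous_on UNIV f" "continuous_on UNIV g"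
  shows "(mult_op act f o\<^sub>L translation_op t) o\<^sub>L (mult_op act g o\<^sub>L translation_op u) =
    mult_op act (\<lambda>x. f x * g (act (- t) x)) o\<^sub>L translation_op (t + u)"
proof -
  have "(mult_op act f o\<^sub>L translation_op t) o\<^sub>L (mult_op act g o\<^sub>L translation_op u) =
      mult_op act f o\<^sub>L ((translation_op t o\<^sub>L mult_op act g) o\<^sub>L translation_op u)"
    by (simp add: blinfun_compose_assoc)
  also have "\<dots> = (mult_op act f o\<^sub>L mult_op act (\<lambda>x. g (act (- t) x))) o\<^sub>L (translation_op t o\<^sub>L
      translation_op u)"
    unfolding translation_mult_op[OF assms(2)] by (simp add: blinfun_compose_assoc)
  finally show ?thesis
    by (simp add: mult_op_compose assms continuous_comp_act translation_op_compose)
qed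

lemma crossed_monomials_compose:
  assumes "a \<in> crossed_monomials act" "b \<in> crossed_monomials act"
  shows "(a o\<^sub>L b) \<in> crossed_monomials act"
proof -
  from assms obtain f t g u where fg: "continuous_on UNIV f" "continuous_on UNIV g"
    and ab: "a = (mult_op act f o\<^sub>L translation_op t)" "b = (mult_op act g o\<^sub>L translation_op u)"
    by (metis crossed_monomialsE)
  show ?thesis
    unfolding ab monomial_compose[OF fg] unfolding crossed_monomials_def
    using fg by (auto intro!: exI continuous_on_mult continuous_comp_act)
qed

lemma crossed_monomials_adj:
  assumes "a \<in> crossed_monomials act"
  shows "adj a \<in> crossed_monomials act"
proof -
  obtain f t where f: "continuous_on UNIV f" and a: "a = (mult_op act f o\<^sub>L translation_op t)"
    using assms by (rule crossed_monomialsE)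
  have "adj a = translation_op (- t) o\<^sub>L mult_op act (\<lambda>x. cnj (f x))"
    by (simp add: a adj_compose mult_op_bounded translation_op_bounded f adj_translation_op
        adj_mult_op)
  thus ?thesis
    unfolding crossed_monomials_def using continuous_on_cnj[OF f]
    by (auto simp: translation_mult_op intro!: exI continuous_comp_act)
qed

lemma reduced_crossed_product_eq: "reduced_crossed_product act =
    closure (span (crossed_monomials act))"
  by (simp add: reduced_crossed_product_def crossed_monomials_def)

lemma scalar_op_monomial: "scalar_op c \<in> crossed_monomials act"
  using mult_op_monomial[of "\<lambda>_. c"] by (simp add: mult_op_const)

lemmas monomial_span = unital_cstar_closure_span[OF crossed_monomials_bounded scalar_op_monomial
  crossed_monomials_compose crossed_monomials_adj]

lemma unital_cstar_crossed_product: "unital_cstar_algebra (reduced_crossed_product act)"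
  unfolding reduced_crossed_product_eq by (rule monomial_span)

lemma span_monomials_subset: "span (crossed_monomials act) \<subseteq> reduced_crossed_product act"
  unfolding reduced_crossed_product_eq by (rule closure_subset)

lemma unital_cstar_commutant:
  "unital_cstar_algebra (relative_commutant (reduced_crossed_product act) (function_algebra act))"
  by (rule unital_cstar_relative_commutant[OF unital_cstar_crossed_product])
    (auto simp: function_algebra_def mult_op_bounded adj_mult_op intro: continuous_on_cnj)

text \<open>C(X) is abelian, hence contained in its own commutant. Consequently a pseudo-expectation
  agrees with \<iota> on the bump functions used below.\<close>

lemma mult_op_commutant:
  assumes "continuous_on UNIV f"
  shows "mult_op act f \<in> relative_commutant (reduced_crossed_product act) (function_algebra act)"
  using assms mult_op_monomial[OF assms] span_monomials_subset span_base
  by (auto simp: relative_commutant_def function_algebra_def mult_op_compose mult.commute)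

text \<open>
  The coefficient \<open>f\<^sub>0\<close> of a finite sum \<open>\<Sum>\<^sub>t f\<^sub>t \<lambda>\<^sub>t\<close>, evaluated at \<open>x\<close>, is the matrix entry
  at any basis vector \<open>(s, -s x)\<close>.
\<close>
lemma continuous_diagonal_coefficient:
  assumes "a \<in> span (crossed_monomials act)"
  shows "continuous_on UNIV (\<lambda>x. coord (blinfun_apply a (ket (s, act (- s) x))) (s, act (- s) x))"
  using assms
proof (induction rule: span_induct_alt)
  case base thus ?case by simp
next
  case (step c a b)
  obtain f t where f: "continuous_on UNIV f" and a: "a = (mult_op act f o\<^sub>L translation_op t)"
    using step(1) by (rule crossed_monomialsE)
  have "coord (blinfun_apply a (ket (s, act (- s) x))) (s, act (- s) x) =
      (if t = 0 then f x else 0)" for x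
  proof -
    have "- t + s = s \<longleftrightarrow> t = 0" by (metis add_0 add_right_cancel neg_equal_0_iff_equal)
    thus ?thesis by (simp add: a coord_mult f coord_translation_op act_simps)
  qed
  hence "continuous_on UNIV (\<lambda>x. coord (blinfun_apply a (ket (s, act (- s) x))) (s, act (- s) x))"
    using f by (cases "t = 0") auto
  with step show ?case by (auto simp: blinfun_rep intro!: continuous_intros)
qed

section \<open>Shrinking open sets and compressing into the commutant\<close>

lemma exists_open_moved_or_fixed:
  assumes V: "open V" "V \<noteq> {}"
  obtains W where "open W" "W \<noteq> {}" "W \<subseteq> V" "\<And>x. x \<in> W \<Longrightarrow> act t x \<in> W \<Longrightarrow> act t x = x"
proof (cases "\<forall>x\<in>V. act t x = x")
  case True
  thus ?thesis using V that by blast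
next
  case False
  then obtain x where x: "x \<in> V" "act t x \<noteq> x" by blast
  then obtain A B where AB: "open A" "open B" "act t x \<in> A" "x \<in> B" "A \<inter> B = {}"
    by (metis hausdorff)
  \<comment> \<open>Around a moved point, separation by \<open>A\<close> and \<open>B\<close> makes
    this set disjoint from its image under t, so the fixing condition holds vacuously.\<close>
  let ?W = "V \<inter> B \<inter> act t -` A"
  have "open ?W"
    using AB V continuous_act[of UNIV t] by (intro open_Int open_vimage)
  moreover have "x \<in> ?W" using x AB by auto
  ultimately show ?thesis using AB by (intro that[of ?W]) auto
qed

text \<open>A compressed monomial h f \<lambda>_t h equals k \<lambda>_t, where k(x) contains the
  factors h(x) and h(t^{-1} x). If k(x) is nonzero, then x and t^{-1} x both lie in W, and W is
  chosen so that t^{-1} then fixes x. Induction on the number of terms shrinks W finitely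
  often.\<close>

lemma locally_compressed_into_commutant:
  assumes "a \<in> span (crossed_monomials act)" "open V" "V \<noteq> {}"
  obtains W where "open W" "W \<noteq> {}" "W \<subseteq> V"
    "\<And>h. continuous_on UNIV h \<Longrightarrow> (\<And>x. x \<notin> W \<Longrightarrow> h x = 0) \<Longrightarrow>
      (mult_op act h o\<^sub>L a o\<^sub>L mult_op act h) \<in> relative_commutant (reduced_crossed_product act)
          (function_algebra act)"
proof -
  let ?Dc = "relative_commutant (reduced_crossed_product act) (function_algebra act)"
  note DcD = unital_cstar_algebraD[OF unital_cstar_commutant]
  note bil = bounded_bilinear_blinfun_compose
  \<comment> \<open>Quantifying over all h supported in the set makes the property pass to smaller
    open sets.\<close>
  let ?P = "\<lambda>a W. \<forall>h. continuous_on UNIV h \<longrightarrow> (\<forall>x. x \<notin> W \<longrightarrow> h x = 0) \<longrightarrow>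
      (mult_op act h o\<^sub>L a o\<^sub>L mult_op act h) \<in> ?Dc"
  have "\<exists>W. open W \<and> W \<noteq> {} \<and> W \<subseteq> V \<and> ?P a W"
    using assms
  proof (induction arbitrary: V rule: span_induct_alt)
    case base thus ?case
      by (intro exI[of _ V]) (simp add: bounded_bilinear.zero_left[OF bil]
          bounded_bilinear.zero_right[OF bil] DcD)
  next
    case (step c a b)
    obtain f t where f: "continuous_on UNIV f" and a: "a = (mult_op act f o\<^sub>L translation_op t)"
      using step(1) by (rule crossed_monomialsE)
    obtain V' where V': "open V'" "V' \<noteq> {}" "V' \<subseteq> V" "\<And>x. x \<in> V' \<Longrightarrow> act (- t) x \<in> V' \<Longrightarrow>
        act (- t) x = x"
      using exists_open_moved_or_fixed[OF step(3,4), of "- t"] by metis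
    \<comment> \<open>The induction hypothesis is applied inside \<open>V'\<close>, so one set
      \<open>W\<close> serves both the new monomial and the remaining sum.\<close>
    obtain W where W: "open W" "W \<noteq> {}" "W \<subseteq> V'" "?P b W"
      using step(2)[OF V'(1,2)] by blast
    have "(mult_op act h o\<^sub>L a o\<^sub>L mult_op act h) \<in> ?Dc"
      if h: "continuous_on UNIV h" "\<forall>x. x \<notin> W \<longrightarrow> h x = 0" for h
    proof -
      define k where "k x = h x * f x * h (act (- t) x)" for x
      have k: "continuous_on UNIV k"
        unfolding k_def by (intro continuous_on_mult continuous_comp_act h f)
      \<comment> \<open>This pointwise identity is exactly what commutation of k \<lambda>_t with
        multiplication by d amounts to after the covariance relation.\<close>
      have inv: "k x * d (act (- t) x) = d x * k x" for d :: "'x \<Rightarrow> complex" and x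
      proof (cases "x \<in> W \<and> act (- t) x \<in> W")
        case True
        hence "act (- t) x = x" using V'(4) W(3) by blast
        thus ?thesis by simp
      qed (use h(2) in \<open>auto simp: k_def\<close>)
      have eq: "(mult_op act h o\<^sub>L a o\<^sub>L mult_op act h) = (mult_op act k o\<^sub>L translation_op t)"
      proof -
        have "(mult_op act h o\<^sub>L a o\<^sub>L mult_op act h) =
            (mult_op act h o\<^sub>L mult_op act f) o\<^sub>L (translation_op t o\<^sub>L mult_op act h)"
          by (simp add: a blinfun_compose_assoc)
        also have "\<dots> = mult_op act (\<lambda>x. h x * f x) o\<^sub>L mult_op act (\<lambda>x. h (act (- t) x)) o\<^sub>L
            translation_op t"
          by (simp add: translation_mult_op mult_op_compose h f blinfun_compose_assoc)
        also have "\<dots> = (mult_op act k o\<^sub>L translation_op t)"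
          by (simp add: mult_op_compose h f continuous_comp_act continuous_on_mult k_def[abs_def])
        finally show ?thesis .
      qed
      have "(mult_op act k o\<^sub>L translation_op t) o\<^sub>L mult_op act d =
          mult_op act d o\<^sub>L (mult_op act k o\<^sub>L translation_op t)"
        if d: "continuous_on UNIV d" for d
      proof -
        have "(mult_op act k o\<^sub>L translation_op t) o\<^sub>L mult_op act d =
            (mult_op act k o\<^sub>L mult_op act (\<lambda>x. d (act (- t) x))) o\<^sub>L translation_op t"
          by (simp add: translation_mult_op d blinfun_compose_assoc)
        also have "\<dots> = (mult_op act d o\<^sub>L mult_op act k) o\<^sub>L translation_op t"
          by (simp add: mult_op_compose d k continuous_comp_act inv)
        finally show ?thesis by (simp add: blinfun_compose_assoc)
      qed
      moreover have "(mult_op act k o\<^sub>L translation_op t) \<in> crossed_monomials act"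
        using k by (auto simp: crossed_monomials_def)
      ultimately show ?thesis
        using span_monomials_subset span_base unfolding eq
        by (auto simp: relative_commutant_def function_algebra_def)
    qed
    hence "?P (c *\<^sub>R a + b) W"
      using W(4) by (simp add: bounded_bilinear.add_left[OF bil] bounded_bilinear.add_right[OF bil]
          bounded_bilinear.scaleR_left[OF bil] bounded_bilinear.scaleR_right[OF bil] DcD)
    thus ?case using W V' by blast
  qed
  thus thesis using that by blast
qed

text \<open>A compact Hausdorff space is normal, so Urysohn's lemma separates the point from the
  complement of \<open>W\<close>.\<close>

lemma exists_bump:
  assumes "open W" "x \<in> W"
  obtains h :: "'x \<Rightarrow> real" where "continuous_on UNIV h" "h x = 1"
    "\<And>y. 0 \<le> h y \<and> h y \<le> 1" "\<And>y. y \<notin> W \<Longrightarrow> h y = 0"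
proof -
  have "normal_space (euclidean :: 'x topology)"
  proof (rule compact_Hausdorff_or_regular_imp_normal_space)
    show "compact_space (euclidean :: 'x topology)" using compact by (simp add: compact_space_def)
    show "Hausdorff_space (euclidean :: 'x topology) \<or> regular_space (euclidean :: 'x topology)"
      by (rule disjI1) (simp add: Hausdorff_space_def disjnt_def, metis hausdorff)
  qed
  moreover have "closedin euclidean (- W)" "closedin euclidean {x}" "disjnt (- W) {x}"
    using assms by (auto simp: disjnt_def)
  ultimately obtain h where h: "continuous_map euclidean (top_of_set {0..1::real}) h"
      "h ` (- W) \<subseteq> {0}" "h ` {x} \<subseteq> {1}"
    using Urysohn_lemma[of euclidean "- W" "{x}" 0 1] by (metis zero_le_one)
  show thesis
    by (rule that[of h]) (use h in \<open>auto simp: continuous_map_in_subtopology\<close>)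
qed

section \<open>Vanishing of the left kernel\<close>

lemma left_kernel_zero:
  fixes I :: "'i op set" and \<iota> E :: "('g \<times> 'x) op \<Rightarrow> 'i op"
  defines "C \<equiv> reduced_crossed_product act"
      and "Dc \<equiv> relative_commutant (reduced_crossed_product act) (function_algebra act)"
  assumes I: "unital_cstar_algebra I" "abelian_ops I" and hom: "unital_star_hom Dc I \<iota>"
      and inj: "inj_on \<iota> Dc"
    and E: "ucp C I E" "\<And>b. b \<in> Dc \<Longrightarrow> E b = \<iota> b"
    and a0: "a0 \<in> C" "E (adj a0 o\<^sub>L a0) = 0"
  shows "a0 = 0"
proof (rule ccontr)
  assume "a0 \<noteq> 0"
  note CA = unital_cstar_crossed_product[folded C_def]
  note CD = unital_cstar_algebraD[OF CA]
  note DcA = unital_cstar_commutant[folded Dc_def]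
  note DcD = unital_cstar_algebraD[OF DcA]
  have DcC: "b \<in> C" if "b \<in> Dc" for b
    using that by (simp add: Dc_def C_def relative_commutant_def)
  have spC: "b \<in> C" if "b \<in> span (crossed_monomials act)" for b
    using that span_monomials_subset by (auto simp: C_def)
  note IB = unital_cstar_algebraD(1)[OF I(1)]
  have Eadd: "E (b + c) = E b + E c" if "b \<in> C" "c \<in> C" for b c
    using E(1) that by (simp add: ucp_def clinear_map_on_def)
  \<comment> \<open>A nonzero complex-linear operator has a nonzero column, by the basis
    expansion.\<close>
  have "\<exists>k. blinfun_apply a0 (ket k) \<noteq> 0"
  proof (rule ccontr)
    assume z: "\<nexists>k. blinfun_apply a0 (ket k) \<noteq> 0"
    have "blinfun_apply a0 \<xi> = 0" for \<xi>
      using blinfun_ket_expansion[OF CD(11)[OF a0(1)], of \<xi>] z has_sum_unique[OF _ has_sum_0] by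
          force
    thus False using \<open>a0 \<noteq> 0\<close> by (auto intro: blinfun_eqI)
  qed
  then obtain s y where sy: "blinfun_apply a0 (ket (s, y)) \<noteq> 0" by auto
  define a where "a = (adj a0 o\<^sub>L a0)"
  have a: "a \<in> C" "adj a = a" "E a = 0"
    using a0 CD by (auto simp: a_def adj_compose adj_adj)
  \<comment> \<open>The diagonal entry of \<open>a\<close> is 4 \<epsilon>. Approximation costs
    \<epsilon>, leaving at least 3 \<epsilon> for \<open>a'\<close>, so the open condition > 2
    \<epsilon> is met and still contradicts the bound \<epsilon> reached at the end.\<close>
  define \<epsilon> where "\<epsilon> = (norm (blinfun_apply a0 (ket (s, y))))\<^sup>2 / 4"
  have \<epsilon>: "\<epsilon> > 0" using sy by (simp add: \<epsilon>_def)
  have a_entry: "cinner (blinfun_apply a (ket (s, y))) (ket (s, y)) = complex_of_real (4 * \<epsilon>)"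
    using a0 CD(11) by (simp add: a_def cinner_adj_left cinner_self \<epsilon>_def del: cinner_ket)
  obtain a1 where a1: "a1 \<in> span (crossed_monomials act)" "dist a1 a < \<epsilon>"
    using a(1) \<epsilon> unfolding C_def reduced_crossed_product_eq closure_approachable by blast
  \<comment> \<open>Averaging with the adjoint makes the approximant self-adjoint; as
    \<open>a\<close> is self-adjoint and \<open>adj\<close> is contractive, the distance to
    \<open>a\<close> does not grow.\<close>
  define a' where "a' = (1/2) *\<^sub>R (a1 + adj a1)"
  have a': "a' \<in> span (crossed_monomials act)" "adj a' = a'"
    using a1(1) monomial_span(2) CD(11)[OF spC]
    by (auto simp: a'_def span_add span_scale adj_scaleR adj_plus adj_adj adj_bounded_ops
        bounded_ops_intros add.commute)
  have near: "norm (a - a') \<le> \<epsilon>"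
  proof -
    have "a - a' = (1/2) *\<^sub>R ((a - a1) + adj (a - a1))"
      using a CD(11) spC[OF a1(1)]
      by (simp add: a'_def adj_minus algebra_simps flip: scaleR_add_left)
    also have "norm \<dots> \<le> (1/2) * (norm (a - a1) + norm (a - a1))"
      using norm_triangle_mono[OF order_refl norm_adj_le,
          of "a - a1" "a - a1"] CD(11) a spC[OF a1(1)]
      by (simp add: bounded_ops_intros)
    finally show ?thesis using a1(2) by (simp add: dist_norm norm_minus_commute)
  qed
  \<comment> \<open>The real part of the coefficient of \<open>a'\<close> at the neutral element, as
    a function on X; at the point \<open>act s y\<close> it is the entry at
    \<open>(s, y)\<close>.\<close>
  define \<phi> where "\<phi> x = Re (coord (blinfun_apply a' (ket (s, act (- s) x))) (s, act (- s) x))" for x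
  define V where "V = {x. 2 * \<epsilon> < \<phi> x}"
  have "open V"
    unfolding V_def \<phi>_def
    by (intro open_Collect_less continuous_on_const continuous_on_Re
        continuous_diagonal_coefficient a')
  moreover have "act s y \<in> V"
  proof -
    have "cmod (cinner (blinfun_apply (a - a') (ket (s, y))) (ket (s, y))) \<le>
        norm (blinfun_apply (a - a') (ket (s, y)))"
      using cmod_cinner_le[of _ "ket (s, y)"] by simp
    also have "\<dots> \<le> norm (a - a')"
      using norm_blinfun[of "a - a'" "ket (s, y)"] by simp
    finally have "cmod (cinner (blinfun_apply (a - a') (ket (s, y))) (ket (s, y))) \<le> \<epsilon>"
      using near by simp
    hence "Re (cinner (blinfun_apply a (ket (s, y))) (ket (s, y)) - cinner (blinfun_apply a'
        (ket (s, y))) (ket (s, y))) \<le> \<epsilon>"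
      using complex_Re_le_cmod order_trans
      by (fastforce simp: blinfun_rep cinner_simps simp del: cinner_ket)
    thus ?thesis
      using \<epsilon> unfolding a_entry by (simp add: V_def \<phi>_def act_simps)
  qed
  ultimately obtain W where W: "open W" "W \<noteq> {}" "W \<subseteq> V"
    "\<And>h. continuous_on UNIV h \<Longrightarrow> (\<And>x. x \<notin> W \<Longrightarrow> h x = 0) \<Longrightarrow>
        (mult_op act h o\<^sub>L a' o\<^sub>L mult_op act h) \<in> Dc"
    using locally_compressed_into_commutant[OF a'(1)] unfolding Dc_def by (metis empty_iff)
  then obtain x where x: "x \<in> W" by blast
  obtain g :: "'x \<Rightarrow> real" where g: "continuous_on UNIV g" "g x = 1"
    "\<And>y. 0 \<le> g y \<and> g y \<le> 1" "\<And>y. y \<notin> W \<Longrightarrow> g y = 0"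
    using exists_bump[OF W(1) x] by blast
  have gc: "continuous_on UNIV (\<lambda>x. complex_of_real (g x))"
    by (intro continuous_on_of_real g)
  define h where "h = mult_op act (\<lambda>x. complex_of_real (g x))"
  have h: "h \<in> Dc" "adj h = h" "norm h \<le> 1"
    using gc mult_op_commutant[OF gc] g(3)
    by (auto simp: h_def Dc_def adj_mult_op intro!: norm_mult_op_le)
  have hC: "h \<in> C" using h(1) by (rule DcC)
  \<comment> \<open>On \<open>Dc\<close> the map \<open>E\<close> is the homomorphism \<iota>, which
    places \<open>h\<close> in the multiplicative domain of \<open>E\<close>.\<close>
  have "E (h o\<^sub>L w) = E h o\<^sub>L E w" if "w \<in> C" for w
  proof (rule ucp_multiplicative_domain(1)[OF CA E(1) IB hC h(2) _ _ that])
    show "adj (E h) = E h" "E (h o\<^sub>L h) = E h o\<^sub>L E h"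
      using hom h DcD(8)[OF h(1) h(1)] by (auto simp: E(2) unital_star_hom_def)
  qed
  moreover have "E (w o\<^sub>L h) = E w o\<^sub>L E h" if "w \<in> C" for w
  proof -
    \<comment> \<open>The right-hand form of the multiplicative domain lemma is stated for an
      adjoint, so it is applied to \<open>adj w\<close>.\<close>
    have "E (adj (adj w) o\<^sub>L h) = E (adj (adj w)) o\<^sub>L E h"
    proof (rule ucp_multiplicative_domain(2)[OF CA E(1) IB hC h(2)])
      show "adj (E h) = E h" "E (h o\<^sub>L h) = E h o\<^sub>L E h"
        using hom h DcD(8)[OF h(1) h(1)] by (auto simp: E(2) unital_star_hom_def)
    qed (intro CD that)
    thus ?thesis using that CD by (simp add: adj_adj)
  qed
  ultimately have Ehah: "E (h o\<^sub>L a o\<^sub>L h) = 0"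
    using hC a(1,3) CD(8) by (simp add: bounded_bilinear.zero_left[OF
        bounded_bilinear_blinfun_compose]
          bounded_bilinear.zero_right[OF bounded_bilinear_blinfun_compose])
  define b where "b = (h o\<^sub>L a' o\<^sub>L h)"
  have b: "b \<in> Dc" "adj b = b"
  proof -
    show "b \<in> Dc" unfolding b_def h_def by (rule W(4)) (use gc g in auto)
    have "a' \<in> bounded_ops" "h \<in> bounded_ops" using CD(11) spC a' hC by auto
    thus "adj b = b"
      by (simp add: b_def adj_compose h a' bounded_ops_intros blinfun_compose_assoc)
  qed
  \<comment> \<open>The inequality b <= \<epsilon> is phrased as positivity of an element of
    \<open>Dc\<close>, where \<iota> can be used.\<close>
  define c where "c = \<epsilon> *\<^sub>R id_blinfun - b"
  have c: "c \<in> Dc" "adj c = c"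
  proof -
    show "c \<in> Dc" unfolding c_def by (intro DcD b)
    show "adj c = c"
      using DcD(4,9,11) b by (simp add: c_def adj_minus adj_scaleR adj_id)
  qed
  have hah: "(h o\<^sub>L a o\<^sub>L h) \<in> C" by (intro CD hC a)
  \<comment> \<open>Adding h a h trades b for h (a - a') h, whose norm is at most \<epsilon>; hence
    the sum is positive.\<close>
  have diff: "c + (h o\<^sub>L a o\<^sub>L h) = \<epsilon> *\<^sub>R id_blinfun + (h o\<^sub>L (a - a') o\<^sub>L h)"
    by (rule blinfun_eqI) (simp add: c_def b_def blinfun_rep blinfun.diff_right)
  have "positive_op (c + (h o\<^sub>L a o\<^sub>L h))"
  proof (rule positive_opI)
    show "c + (h o\<^sub>L a o\<^sub>L h) \<in> bounded_ops"
      by (intro CD(6,11) hah DcC c)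
    show "adj (c + (h o\<^sub>L a o\<^sub>L h)) = c + (h o\<^sub>L a o\<^sub>L h)"
      using CD(11) DcC[OF c(1)] hC a hah c h
      by (simp add: adj_plus adj_compose bounded_ops_intros blinfun_compose_assoc)
    fix \<xi>
    have "norm (h o\<^sub>L (a - a') o\<^sub>L h) \<le> norm h * norm (a - a') * norm h"
      by (meson norm_blinfun_compose mult_right_mono norm_ge_zero order_trans)
    also have "\<dots> \<le> 1 * \<epsilon> * 1"
      using near h \<epsilon> by (intro mult_mono) auto
    finally have n: "norm (h o\<^sub>L (a - a') o\<^sub>L h) \<le> \<epsilon>" by simp
    have "- Re (cinner (blinfun_apply (h o\<^sub>L (a - a') o\<^sub>L h) \<xi>) \<xi>) \<le>
        norm (blinfun_apply (h o\<^sub>L (a - a') o\<^sub>L h) \<xi>) * norm \<xi>"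
      using cmod_cinner_le abs_Re_le_cmod abs_le_D2 order_trans by blast
    also have "\<dots> \<le> \<epsilon> * norm \<xi> * norm \<xi>"
      by (intro mult_right_mono order_trans[OF norm_blinfun] n) auto
    finally show "Re (cinner (blinfun_apply (c + (h o\<^sub>L a o\<^sub>L h)) \<xi>) \<xi>) \<ge> 0"
      unfolding diff
      by (simp add: blinfun_rep cinner_simps cinner_self power2_eq_square mult.assoc
          del: of_real_mult of_real_power)
  qed
  hence "positive_op (E (c + (h o\<^sub>L a o\<^sub>L h)))"
    using CD DcC[OF c(1)] hah by (intro ucp_positive[OF E(1) IB]) auto
  \<comment> \<open>\<open>E\<close> annihilates h a h and agrees with \<iota> on \<open>c\<close>,
    so positivity survives the removal of h a h.\<close>
  hence "positive_op (\<iota> c)"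
    using Eadd[OF DcC[OF c(1)] hah] E(2)[OF c(1)] Ehah by simp
  \<comment> \<open>That \<iota> preserves positivity on \<open>Dc\<close> is inherited from
    \<open>E\<close>; its injectivity pulls positivity of \<iota> c back to c.\<close>
  hence "positive_op c"
    using injective_hom_reflects_positive[OF DcA hom inj I(2) _ c] ucp_positive[OF E(1) IB DcC]
        E(2) by metis
  hence "Re (cinner (blinfun_apply c (ket (s, act (- s) x))) (ket (s, act (- s) x))) \<ge> 0"
    by (simp add: positive_op_def complex_nonneg_Reals_iff del: cinner_ket)
  \<comment> \<open>The bump equals 1 at x, so \<open>h\<close> fixes this basis vector and the
    compression does not change the diagonal entry there.\<close>
  moreover have "blinfun_apply h (ket (s, act (- s) x)) = ket (s, act (- s) x)"
    by (simp add: h_def mult_op_ket gc act_simps g)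
  hence "cinner (blinfun_apply b (ket (s, act (- s) x))) (ket (s, act (- s) x)) =
      cinner (blinfun_apply a' (ket (s, act (- s) x))) (ket (s, act (- s) x))"
    using selfadjoint_cinner[of h "blinfun_apply a' (ket (s, act (- s) x))"] CD(11)[OF hC] h(2)
    by (simp add: b_def del: cinner_ket)
  ultimately have "\<phi> x \<le> \<epsilon>"
    by (simp add: c_def blinfun_rep \<phi>_def)
  thus False using x W(3) \<epsilon> by (auto simp: V_def)
qed

end

theorem theorem6p9:
  fixes act :: "'g::group_add \<Rightarrow> 'x::t2_space \<Rightarrow> 'x"
    and C D Dc :: "('g \<times> 'x) op set"
    and I :: "'i op set"
    and \<iota> E :: "('g \<times> 'x) op \<Rightarrow> 'i op"
  assumes "compact (UNIV :: 'x set)"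
    and "continuous_action act"
    and "D = function_algebra act"
    and "C = reduced_crossed_product act"
    and "Dc = relative_commutant C D"
    and "\<And>x s t. s \<in> germ_isotropy act x \<Longrightarrow> t \<in> germ_isotropy act x \<Longrightarrow> s + t = t + s"
    and "injective_envelope Dc I \<iota>"
    and "pseudo_expectation C Dc I \<iota> E"
  shows "left_kernel C E = {0}"
proof
  show "left_kernel C E \<subseteq> {0}"
    using left_kernel_zero[OF assms(1,2), of I \<iota> E] assms(3-5,7,8)
    by (auto simp: left_kernel_def injective_envelope_def pseudo_expectation_def)
  have C: "unital_cstar_algebra C"
    unfolding assms(4) by (rule unital_cstar_crossed_product[OF assms(1,2)])
  \<comment> \<open>Additivity at zero forces \<open>E 0 = 0\<close>, which puts 0 into the left
    kernel.\<close>
  have "E (0 + 0) = E 0 + E 0"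
    using assms(8) unital_cstar_algebraD(5)[OF C]
        unfolding pseudo_expectation_def ucp_def clinear_map_on_def by blast
  thus "{0} \<subseteq> left_kernel C E"
    using unital_cstar_algebraD(5)[OF C]
    by (simp add: left_kernel_def bounded_bilinear.zero_right[OF bounded_bilinear_blinfun_compose])
qed

end
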